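(* Let $M$ be a locally compact, connected metric space with a $C^0$ flow $\theta$ and let $K$ be a compact, invariant, proper subset of $M$. Then: either (I) $K$ is an attractor; or (II) $K$ is a repeller; or (III) $K$ is isolated from minimal sets and stagnant; or (IV) there are a nonvoid, compact, connected invariant set $Q\subset \mathrm{bd}\,K$ and a sequence $(\Lambda_n)$ of compact minimal sets of the flow, $\Lambda_n\subset M\setminus K$, such that the following three conditions hold: (a) $(\Lambda_n)$ converges to $Q$ in the Hausdorff metric; (b) all $\Lambda_n$ belong to the same one of the following three classes: equilibrium orbits, periodic orbits, aperiodic compact minimal sets; (c) either all $\Lambda_n$ are attractors, or all $\Lambda_n$ are repellers, or all $\Lambda_n$ are isolated from minimal sets and stagnant; or (V) for all sufficiently small open neighbourhoods $U$ of $K$, the compact minimal sets contained in $U\setminus K$ form a nonvoid $\mathfrak c$-dense in itself set, i.e. this set is nonvoid and any neighbourhood (in $M$) of a compact minimal set $\Lambda\subset U\setminus K$ contains a continuum of compact minimal sets. Finally, if none of the conditions (I) to (V) holds, then (VI) given any neighbourhood $U$ of $K$, there is a sequence of orbits $\gamma_n\subset U\setminus K$, $n\ge 1$, such that $$\mathrm{cl}\,\gamma_1\supsetneq \mathrm{cl}\,\gamma_2\supsetneq\cdots\supsetneq\mathrm{cl}\,\gamma_n\supsetneq\cdots .$$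
   Context: A $C^0$ flow on $M$ is a continuous action $\theta:\mathbb R\times M\to M$ of $(\mathbb R,+)$. A set is invariant if it is a union of orbits $\mathcal O(x)=\{\theta(t,x):t\in\mathbb R\}$; $\mathcal O^{+}(x)$, $\mathcal O^-(x)$ are the half orbits ($t\ge 0$, $t\le 0$) and $\mathcal O^{\pm}(V)=\bigcup_{x\in V}\mathcal O^{\pm}(x)$. $\omega(x),\alpha(x)$ are the usual $\omega$- and $\alpha$-limit sets (possibly empty). $\mathrm{cl}$, $\mathrm{bd}$ denote closure and boundary in $M$. A neighbourhood of a set is a set whose interior contains it. A minimal set is a nonvoid, closed, invariant set containing no proper subset with these three properties. An equilibrium orbit is a singleton $\{z\}$ with $\theta(t,z)=z$ for all $t$. A periodic orbit is an orbit $\mathcal O(x)$ with $\{t:\theta(t,x)=x\}=\lambda\mathbb Z$ for some $\lambda>0$. An aperiodic minimal set is a minimal set that is neither an equilibrium orbit nor a periodic orbit. For a compact invariant set $X$: $B^{+}(X)=\{x\in M:\emptyset\ne\omega(x)\subset X\}$, $B^{-}(X)=\{x\in M:\emptyset\ne\alpha(x)\subset X\}$. $X$ is stable if every neighbourhood $U$ of $X$ contains $\mathcal O^+(V)$ for some neighbourhood $V$ of $X$; negatively stable if the same holds with $\mathcal O^-(V)$. $X$ is an attractor if it is stable and $B^+(X)$ is a neighbourhood of $X$; a repeller if it is negatively stable and $B^-(X)$ is a neighbourhood of $X$. $X$ is stagnant if there are $x,y\in M\setminus X$ with $\emptyset\neq\alpha(x)\subset X$ and $\emptyset\ne\omega(y)\subset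 X$. $X$ is isolated from minimal sets if some neighbourhood $U$ of $X$ is such that $U\setminus X$ contains no minimal set of the flow. Let $\mathrm C(M)$ be the set of nonvoid compact subsets of $M$ with the Hausdorff metric $d_H$, and let $\mathfrak c$ be the cardinal of the continuum. A set $\mathfrak C\subset \mathrm C(M)$ is $\mathfrak c$-dense in itself if for every $\Lambda\in\mathfrak C$ and $\epsilon>0$ the set $\{Y\in\mathfrak C: d_H(\Lambda,Y)<\epsilon\}$ has cardinality at least $\mathfrak c$. *)

theory Defs
  imports "HOL-Analysis.Analysis" "HOL-Library.Equipollence"
begin

definition C0_flow :: "(real \<Rightarrow> 'a::topological_space \<Rightarrow> 'a) \<Rightarrow> bool" where
  "C0_flow \<theta> \<longleftrightarrow>
     continuous_on UNIV (\<lambda>(t, x). \<theta> t x) \<and>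
     (\<forall>x. \<theta> 0 x = x) \<and>
     (\<forall>s t x. \<theta> (s + t) x = \<theta> s (\<theta> t x))"

definition flow_orbit :: "(real \<Rightarrow> 'a \<Rightarrow> 'a) \<Rightarrow> 'a \<Rightarrow> 'a set" where
  "flow_orbit \<theta> x = {\<theta> t x |t. True}"

definition pos_orbit :: "(real \<Rightarrow> 'a \<Rightarrow> 'a) \<Rightarrow> 'a \<Rightarrow> 'a set" where
  "pos_orbit \<theta> x = {\<theta> t x |t. t \<ge> 0}"

definition neg_orbit :: "(real \<Rightarrow> 'a \<Rightarrow> 'a) \<Rightarrow> 'a \<Rightarrow> 'a set" where
  "neg_orbit \<theta> x = {\<theta> t x |t. t \<le> 0}"

definition flow_invariant :: "(real \<Rightarrow> 'a \<Rightarrow> 'a) \<Rightarrow> 'a set \<Rightarrow> bool" where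
  "flow_invariant \<theta> X \<longleftrightarrow> (\<exists>S. X = (\<Union>x\<in>S. flow_orbit \<theta> x))"

definition omega_limit :: "(real \<Rightarrow> 'a::topological_space \<Rightarrow> 'a) \<Rightarrow> 'a \<Rightarrow> 'a set" where
  "omega_limit \<theta> x =
     {y. \<exists>s::nat \<Rightarrow> real. filterlim s at_top sequentially \<and> (\<lambda>n. \<theta> (s n) x) \<longlonglongrightarrow> y}"

definition alpha_limit :: "(real \<Rightarrow> 'a::topological_space \<Rightarrow> 'a) \<Rightarrow> 'a \<Rightarrow> 'a set" where
  "alpha_limit \<theta> x =
     {y. \<exists>s::nat \<Rightarrow> real. filterlim s at_bot sequentially \<and> (\<lambda>n. \<theta> (s n) x) \<longlonglongrightarrow> y}"

definition nbhd :: "'a::topological_space set \<Rightarrow> 'a set \<Rightarrow> bool" where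
  "nbhd U X \<longleftrightarrow> X \<subseteq> interior U"

definition minimal_set :: "(real \<Rightarrow> 'a::topological_space \<Rightarrow> 'a) \<Rightarrow> 'a set \<Rightarrow> bool" where
  "minimal_set \<theta> X \<longleftrightarrow>
     X \<noteq> {} \<and> closed X \<and> flow_invariant \<theta> X \<and>
     \<not> (\<exists>Y. Y \<subset> X \<and> Y \<noteq> {} \<and> closed Y \<and> flow_invariant \<theta> Y)"

definition equilibrium_orbit :: "(real \<Rightarrow> 'a \<Rightarrow> 'a) \<Rightarrow> 'a set \<Rightarrow> bool" where
  "equilibrium_orbit \<theta> X \<longleftrightarrow> (\<exists>z. X = {z} \<and> (\<forall>t. \<theta> t z = z))"

definition periodic_orbit :: "(real \<Rightarrow> 'a \<Rightarrow> 'a) \<Rightarrow> 'a set \<Rightarrow> bool" where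
  "periodic_orbit \<theta> X \<longleftrightarrow>
     (\<exists>x. X = flow_orbit \<theta> x \<and>
        (\<exists>l>0. {t. \<theta> t x = x} = {l * of_int k |k::int. True}))"

definition aperiodic_minimal_set :: "(real \<Rightarrow> 'a::topological_space \<Rightarrow> 'a) \<Rightarrow> 'a set \<Rightarrow> bool" where
  "aperiodic_minimal_set \<theta> X \<longleftrightarrow>
     minimal_set \<theta> X \<and> \<not> equilibrium_orbit \<theta> X \<and> \<not> periodic_orbit \<theta> X"

text \<open>The following notions are meant for compact invariant \<open>X\<close> and are applied only to such sets.\<close>

definition basin_pos :: "(real \<Rightarrow> 'a::topological_space \<Rightarrow> 'a) \<Rightarrow> 'a set \<Rightarrow> 'a set" where
  "basin_pos \<theta> X = {x. omega_limit \<theta> x \<noteq> {} \<and> omega_limit \<theta> x \<subseteq> X}"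

definition basin_neg :: "(real \<Rightarrow> 'a::topological_space \<Rightarrow> 'a) \<Rightarrow> 'a set \<Rightarrow> 'a set" where
  "basin_neg \<theta> X = {x. alpha_limit \<theta> x \<noteq> {} \<and> alpha_limit \<theta> x \<subseteq> X}"

definition flow_stable :: "(real \<Rightarrow> 'a::topological_space \<Rightarrow> 'a) \<Rightarrow> 'a set \<Rightarrow> bool" where
  "flow_stable \<theta> X \<longleftrightarrow>
     (\<forall>U. nbhd U X \<longrightarrow> (\<exists>V. nbhd V X \<and> (\<Union>x\<in>V. pos_orbit \<theta> x) \<subseteq> U))"

definition flow_neg_stable :: "(real \<Rightarrow> 'a::topological_space \<Rightarrow> 'a) \<Rightarrow> 'a set \<Rightarrow> bool" where
  "flow_neg_stable \<theta> X \<longleftrightarrow>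
     (\<forall>U. nbhd U X \<longrightarrow> (\<exists>V. nbhd V X \<and> (\<Union>x\<in>V. neg_orbit \<theta> x) \<subseteq> U))"

definition attractor :: "(real \<Rightarrow> 'a::topological_space \<Rightarrow> 'a) \<Rightarrow> 'a set \<Rightarrow> bool" where
  "attractor \<theta> X \<longleftrightarrow> flow_stable \<theta> X \<and> nbhd (basin_pos \<theta> X) X"

definition repeller :: "(real \<Rightarrow> 'a::topological_space \<Rightarrow> 'a) \<Rightarrow> 'a set \<Rightarrow> bool" where
  "repeller \<theta> X \<longleftrightarrow> flow_neg_stable \<theta> X \<and> nbhd (basin_neg \<theta> X) X"

definition stagnant :: "(real \<Rightarrow> 'a::topological_space \<Rightarrow> 'a) \<Rightarrow> 'a set \<Rightarrow> bool" where
  "stagnant \<theta> X \<longleftrightarrow>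
     (\<exists>x y. x \<notin> X \<and> y \<notin> X \<and>
        alpha_limit \<theta> x \<noteq> {} \<and> alpha_limit \<theta> x \<subseteq> X \<and>
        omega_limit \<theta> y \<noteq> {} \<and> omega_limit \<theta> y \<subseteq> X)"

definition isolated_from_minimal_sets :: "(real \<Rightarrow> 'a::topological_space \<Rightarrow> 'a) \<Rightarrow> 'a set \<Rightarrow> bool" where
  "isolated_from_minimal_sets \<theta> X \<longleftrightarrow>
     (\<exists>U. nbhd U X \<and> \<not> (\<exists>\<Lambda>. minimal_set \<theta> \<Lambda> \<and> \<Lambda> \<subseteq> U - X))"

definition hausdorff_dist :: "'a::metric_space set \<Rightarrow> 'a set \<Rightarrow> real" where
  "hausdorff_dist A B = max (SUP a\<in>A. infdist a B) (SUP b\<in>B. infdist b A)"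
  \<comment> \<open>Used only for nonempty compact sets, where both suprema are finite.\<close>

definition c_dense_in_itself :: "'a::metric_space set set \<Rightarrow> bool" where
  "c_dense_in_itself \<C> \<longleftrightarrow>
     (\<forall>\<Lambda>\<in>\<C>. \<forall>\<epsilon>>0. (UNIV :: real set) \<lesssim> {Y \<in> \<C>. hausdorff_dist \<Lambda> Y < \<epsilon>})"

definition compact_minimal_sets_in ::
    "(real \<Rightarrow> 'a::topological_space \<Rightarrow> 'a) \<Rightarrow> 'a set \<Rightarrow> 'a set set" where
  "compact_minimal_sets_in \<theta> S = {\<Lambda>. compact \<Lambda> \<and> minimal_set \<theta> \<Lambda> \<and> \<Lambda> \<subseteq> S}"

end

theory Submission
  imports Defs
begin

text \<open>
  If all other alternatives fail, there is a sequence of minimal sets as in the fourth one. Indeed, as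
  the last alternative fails, some neighbourhood of \<open>K\<close> admits no infinite strictly
  descending sequence of closures of orbits lying in it off \<open>K\<close>. Inclusion of orbit
  closures is then well-founded, and below each such orbit there is one whose closure \<open>Z\<close>
  is minimal, except that it may meet \<open>K\<close> (\<open>minimal_closure_below\<close>).

  The central fact is local (\<open>minimal_set_near_of_not_tame\<close>). Call a compact invariant set
  tame if it is an attractor, a repeller, or both stagnant and isolated from minimal sets. If
  \<open>K\<close> is not tame, then every neighbourhood of it contains a compact minimal set off
  \<open>K\<close>. Otherwise every closure \<open>Z\<close> as above meets \<open>K\<close>. Following
  the points that leave a neighbourhood of \<open>K\<close> back from their exit
  (\<open>exit_point\<close>) then gives an orbit outside \<open>K\<close> whose
  \<open>\<alpha>\<close>-limit is in \<open>K\<close>, either directly or inside some \<open>Z\<close>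
  (\<open>alpha_asymptotic_in_closure\<close>). By time reversal there is also one whose
  \<open>\<omega>\<close>-limit is in \<open>K\<close>, so \<open>K\<close> is stagnant and isolated
  from minimal sets, a contradiction.

  The same fact applies to each compact minimal set near \<open>K\<close> in the place of
  \<open>K\<close>. As the alternative about continua of minimal sets fails, every neighbourhood of
  \<open>K\<close> contains, off \<open>K\<close>, a compact minimal set with a neighbourhood
  \<open>N\<close> holding fewer than continuum many compact minimal sets. If none of those near it were
  tame, each would be approached by further ones, and a Cantor scheme would produce a continuum of them
  in \<open>N\<close> (\<open>continuum_of_minimal_sets\<close>). Hence tame minimal sets occur
  arbitrarily close to \<open>K\<close>. By the pigeonhole principle and Blaschke's selection theorem
  some sequence of them is of constant type and converges in the Hausdorff metric; the limit is the
  required set \<open>Q\<close>.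
\<close>

section \<open>Descending orbit closures and tame sets\<close>

text \<open>
  A descending chain condition for orbit closures. Only the orbits are confined to
  \<open>S\<close>: with \<open>S = U - K\<close> their closures may well reach into \<open>K\<close>, and the delicate part of the
  argument deals with exactly those.
\<close>

definition orbit_dcc :: "(real \<Rightarrow> 'a::topological_space \<Rightarrow> 'a) \<Rightarrow> 'a set \<Rightarrow> bool" where
  "orbit_dcc \<theta> S \<longleftrightarrow>
     \<not> (\<exists>x :: nat \<Rightarrow> 'a. \<forall>n. flow_orbit \<theta> (x n) \<subseteq> S
          \<and> closure (flow_orbit \<theta> (x (Suc n))) \<subset> closure (flow_orbit \<theta> (x n)))"

text \<open>
  The disjunction occurs twice in the theorem: as its first three alternatives, applied to \<open>K\<close>, and
  in the fourth one, applied to the members of the sequence of minimal sets.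
\<close>

definition tame :: "(real \<Rightarrow> 'a::topological_space \<Rightarrow> 'a) \<Rightarrow> 'a set \<Rightarrow> bool" where
  "tame \<theta> X \<longleftrightarrow> attractor \<theta> X \<or> repeller \<theta> X \<or>
     (isolated_from_minimal_sets \<theta> X \<and> stagnant \<theta> X)"

lemma orbit_dcc_mono:
  fixes \<theta> :: "real \<Rightarrow> 'a::topological_space \<Rightarrow> 'a"
  assumes "orbit_dcc \<theta> S" "T \<subseteq> S" shows "orbit_dcc \<theta> T"
  unfolding orbit_dcc_def
proof
  assume "\<exists>x :: nat \<Rightarrow> 'a. \<forall>n. flow_orbit \<theta> (x n) \<subseteq> T
          \<and> closure (flow_orbit \<theta> (x (Suc n))) \<subset> closure (flow_orbit \<theta> (x n))"
  then obtain x :: "nat \<Rightarrow> 'a" where x: "\<And>n. flow_orbit \<theta> (x n) \<subseteq> T"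
      "\<And>n. closure (flow_orbit \<theta> (x (Suc n))) \<subset> closure (flow_orbit \<theta> (x n))" by metis
  have "\<And>n. flow_orbit \<theta> (x n) \<subseteq> S" using x(1) assms(2) by (rule order_trans)
  with x(2) assms(1) show False unfolding orbit_dcc_def by metis
qed

lemma compact_nbhd_within:
  fixes K :: "'a::metric_space set"
  assumes lc: "locally compact (UNIV :: 'a set)" and "compact K" "open W" "K \<subseteq> W"
  obtains C where "compact C" "K \<subseteq> interior C" "C \<subseteq> W"
proof -
  have "\<exists>O' C. open O' \<and> compact C \<and> x \<in> O' \<and> O' \<subseteq> C \<and> C \<subseteq> W" if "x \<in> K" for x
  proof -
    have "openin (top_of_set UNIV) W \<and> x \<in> W" using assms that by auto
    then obtain u v where "openin (top_of_set UNIV) u" "compact v" "x \<in> u" "u \<subseteq> v" "v \<subseteq> W"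
      using lc unfolding locally_def by meson
    then show ?thesis by auto
  qed
  then obtain O' C where OC: "\<And>x. x \<in> K \<Longrightarrow> open (O' x) \<and> compact (C x) \<and> x \<in> O' x \<and> O' x \<subseteq> C x \<and> C x \<subseteq> W"
    by metis
  obtain D where D: "D \<subseteq> K" "finite D" "K \<subseteq> (\<Union>x\<in>D. O' x)"
    using compactE_image[OF \<open>compact K\<close>, of K O'] OC by blast
  show ?thesis
  proof
    show "compact (\<Union>x\<in>D. C x)" using D OC by blast
    have "(\<Union>x\<in>D. O' x) \<subseteq> interior (\<Union>x\<in>D. C x)"
    proof (rule interior_maximal)
      show "(\<Union>x\<in>D. O' x) \<subseteq> (\<Union>x\<in>D. C x)" using D(1) OC by fast
      show "open (\<Union>x\<in>D. O' x)" using D OC by blast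
    qed
    with D show "K \<subseteq> interior (\<Union>x\<in>D. C x)" by blast
    show "(\<Union>x\<in>D. C x) \<subseteq> W" using D OC by blast
  qed
qed

section \<open>Time reversal\<close>

text \<open>
  Reversing time exchanges attractors with repellers and \<open>\<omega>\<close>-limits with \<open>\<alpha>\<close>-limits, and leaves
  orbits and minimal sets alone. The facts about \<open>\<omega>\<close>-limits are obtained in this way from those about
  \<open>\<alpha>\<close>-limits.
\<close>

lemma orbit_reverse: "flow_orbit (\<lambda>t. \<theta> (- t)) = flow_orbit \<theta>"
  unfolding flow_orbit_def by (intro ext) (metis add.inverse_inverse)

lemma invariant_reverse: "flow_invariant (\<lambda>t. \<theta> (- t)) = flow_invariant \<theta>"
  unfolding flow_invariant_def orbit_reverse ..

lemma minimal_reverse: "minimal_set (\<lambda>t. \<theta> (- t)) = minimal_set \<theta>"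
  unfolding minimal_set_def invariant_reverse ..

lemma pos_orbit_reverse: "pos_orbit (\<lambda>t. \<theta> (- t)) = neg_orbit \<theta>"
  unfolding pos_orbit_def neg_orbit_def
  by (intro ext) (metis add.inverse_inverse neg_le_0_iff_le)

lemma neg_orbit_reverse: "neg_orbit (\<lambda>t. \<theta> (- t)) = pos_orbit \<theta>"
  using pos_orbit_reverse[of "\<lambda>t. \<theta> (- t)"] by simp

lemma omega_reverse: "omega_limit (\<lambda>t. \<theta> (- t)) = alpha_limit \<theta>"
proof -
  have "(\<exists>s. filterlim s at_top sequentially \<and> (\<lambda>n. \<theta> (- s n) x) \<longlonglongrightarrow> y)
      \<longleftrightarrow> (\<exists>s. filterlim s at_bot sequentially \<and> (\<lambda>n. \<theta> (s n) x) \<longlonglongrightarrow> y)"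
    (is "?l = ?r") for x y
  proof
    assume ?l
    then obtain s where "filterlim s at_top sequentially" "(\<lambda>n. \<theta> (- s n) x) \<longlonglongrightarrow> y" by blast
    then show ?r
      by (intro exI[of _ "\<lambda>n. - s n"]) (simp add: filterlim_uminus_at_top)
  next
    assume ?r
    then obtain s where "filterlim s at_bot sequentially" "(\<lambda>n. \<theta> (s n) x) \<longlonglongrightarrow> y" by blast
    then show ?l
      by (intro exI[of _ "\<lambda>n. - s n"]) (simp add: filterlim_uminus_at_bot)
  qed
  then show ?thesis unfolding omega_limit_def alpha_limit_def by simp
qed

lemma alpha_reverse: "alpha_limit (\<lambda>t. \<theta> (- t)) = omega_limit \<theta>"
  using omega_reverse[of "\<lambda>t. \<theta> (- t)"] by simp

lemma attractor_reverse: "attractor (\<lambda>t. \<theta> (- t)) = repeller \<theta>"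
  unfolding attractor_def repeller_def flow_stable_def flow_neg_stable_def pos_orbit_reverse
    basin_pos_def basin_neg_def omega_reverse ..

lemma orbit_dcc_reverse: "orbit_dcc (\<lambda>t. \<theta> (- t)) = orbit_dcc \<theta>"
  unfolding orbit_dcc_def orbit_reverse ..

section \<open>Orbits, invariant sets and limit sets\<close>

locale metric_flow =
  fixes \<theta> :: "real \<Rightarrow> 'a::metric_space \<Rightarrow> 'a"
  assumes flow: "C0_flow \<theta>"
begin

lemma flow_zero [simp]: "\<theta> 0 x = x"
  using flow unfolding C0_flow_def by blast

lemma flow_add: "\<theta> s (\<theta> t x) = \<theta> (s + t) x"
  using flow unfolding C0_flow_def by metis

lemma flow_continuous: "continuous_on UNIV (\<lambda>(t, x). \<theta> t x)"
  using flow unfolding C0_flow_def by blast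

lemma flow_tendsto:
  assumes "(s \<longlongrightarrow> t) F" "(f \<longlongrightarrow> x) F"
  shows "((\<lambda>n. \<theta> (s n) (f n)) \<longlongrightarrow> \<theta> t x) F"
proof -
  have "((\<lambda>n. (case (s n, f n) of (t, x) \<Rightarrow> \<theta> t x)) \<longlongrightarrow> (case (t, x) of (t, x) \<Rightarrow> \<theta> t x)) F"
    by (rule continuous_on_tendsto_compose[OF flow_continuous tendsto_Pair[OF assms]]) auto
  then show ?thesis by simp
qed

lemma reversed: "metric_flow (\<lambda>t. \<theta> (- t))"
proof
  have "continuous_on UNIV ((\<lambda>(t, x). \<theta> t x) \<circ> (\<lambda>(t, x). (- t, x)))"
    by (intro continuous_on_compose continuous_on_subset[OF flow_continuous])
      (auto simp: case_prod_unfold intro!: continuous_intros)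
  then show "C0_flow (\<lambda>t. \<theta> (- t))"
    unfolding C0_flow_def by (auto simp: o_def case_prod_unfold flow_add)
qed

lemma orbit_self [simp]: "x \<in> flow_orbit \<theta> x"
  unfolding flow_orbit_def using flow_zero by (metis (mono_tags) mem_Collect_eq)

lemma orbit_step: "\<theta> t x \<in> flow_orbit \<theta> x"
  unfolding flow_orbit_def by auto

lemma invariant_iff: "flow_invariant \<theta> X \<longleftrightarrow> (\<forall>x\<in>X. \<forall>t. \<theta> t x \<in> X)"
proof
  assume "flow_invariant \<theta> X"
  then obtain S where S: "X = (\<Union>x\<in>S. flow_orbit \<theta> x)" unfolding flow_invariant_def by blast
  show "\<forall>x\<in>X. \<forall>t. \<theta> t x \<in> X"
    unfolding S by (auto simp: flow_orbit_def) (metis flow_add)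
next
  assume "\<forall>x\<in>X. \<forall>t. \<theta> t x \<in> X"
  then have "X = (\<Union>x\<in>X. flow_orbit \<theta> x)"
    using orbit_self by (fastforce simp: flow_orbit_def)
  then show "flow_invariant \<theta> X" unfolding flow_invariant_def by blast
qed

lemma invariantD: "flow_invariant \<theta> X \<Longrightarrow> x \<in> X \<Longrightarrow> \<theta> t x \<in> X"
  using invariant_iff by blast

lemma orbit_subset: "flow_invariant \<theta> X \<Longrightarrow> x \<in> X \<Longrightarrow> flow_orbit \<theta> x \<subseteq> X"
  unfolding flow_orbit_def using invariantD by blast

lemma closure_orbit_subset:
  "flow_invariant \<theta> X \<Longrightarrow> closed X \<Longrightarrow> x \<in> X \<Longrightarrow> closure (flow_orbit \<theta> x) \<subseteq> X"
  by (simp add: closure_minimal orbit_subset)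

lemma orbit_invariant: "flow_invariant \<theta> (flow_orbit \<theta> x)"
  unfolding invariant_iff by (auto simp: flow_orbit_def flow_add)

lemma closure_invariant:
  assumes "flow_invariant \<theta> X" shows "flow_invariant \<theta> (closure X)"
  unfolding invariant_iff
proof (intro ballI allI)
  fix x t assume "x \<in> closure X"
  then obtain f where f: "\<And>n. f n \<in> X" "f \<longlonglongrightarrow> x" unfolding closure_sequential by blast
  have "(\<lambda>n. \<theta> t (f n)) \<longlonglongrightarrow> \<theta> t x" by (intro flow_tendsto f tendsto_const)
  then show "\<theta> t x \<in> closure X"
    unfolding closure_sequential using f invariantD[OF assms] by (intro exI[of _ "\<lambda>n. \<theta> t (f n)"]) auto
qed

lemma not_in_invariant: "flow_invariant \<theta> K \<Longrightarrow> x \<notin> K \<Longrightarrow> \<theta> t x \<notin> K"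
  using invariantD[of K "\<theta> t x" "- t"] by (auto simp: flow_add)

lemma orbit_subset_Diff:
  "flow_invariant \<theta> K \<Longrightarrow> x \<notin> K \<Longrightarrow> flow_orbit \<theta> x \<subseteq> C \<Longrightarrow> flow_orbit \<theta> x \<subseteq> C - K"
  using not_in_invariant unfolding flow_orbit_def by auto

lemma minimal_set_connected:
  assumes "minimal_set \<theta> X" shows "connected X"
proof -
  obtain x where "x \<in> X" using assms unfolding minimal_set_def by blast
  have "closure (flow_orbit \<theta> x) \<subseteq> X"
    using closure_orbit_subset assms \<open>x \<in> X\<close> unfolding minimal_set_def by blast
  moreover have "\<not> closure (flow_orbit \<theta> x) \<subset> X"
    using assms closure_invariant[OF orbit_invariant] orbit_self[of x] closure_subset closed_closure
    unfolding minimal_set_def by (metis closure_eq_empty empty_iff)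
  ultimately have X: "X = closure (flow_orbit \<theta> x)" by blast
  have "connected ((\<lambda>t. \<theta> t x) ` UNIV)"
  proof (rule connected_continuous_image)
    show "continuous_on UNIV (\<lambda>t. \<theta> t x)"
      unfolding continuous_on_def by (auto intro!: flow_tendsto tendsto_intros)
  qed simp
  moreover have "(\<lambda>t. \<theta> t x) ` UNIV = flow_orbit \<theta> x" unfolding flow_orbit_def by auto
  ultimately show ?thesis unfolding X by (simp add: connected_imp_connected_closure)
qed

lemma minimal_set_eq_of_subset:
  "minimal_set \<theta> X \<Longrightarrow> Y \<subseteq> X \<Longrightarrow> Y \<noteq> {} \<Longrightarrow> closed Y \<Longrightarrow> flow_invariant \<theta> Y \<Longrightarrow> Y = X"
  unfolding minimal_set_def by blast

lemma minimal_sets_disjoint: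
  assumes "minimal_set \<theta> X" "minimal_set \<theta> Y" "X \<noteq> Y" shows "X \<inter> Y = {}"
proof (rule ccontr)
  assume ne: "X \<inter> Y \<noteq> {}"
  have "closed (X \<inter> Y)" "flow_invariant \<theta> (X \<inter> Y)"
    using assms unfolding minimal_set_def invariant_iff by auto
  then have "X \<inter> Y = X" "X \<inter> Y = Y"
    using ne minimal_set_eq_of_subset assms(1,2) by (metis inf_le1, metis inf_le2)
  with assms(3) show False by simp
qed

lemma alpha_limit_nonempty:
  assumes "compact C" "neg_orbit \<theta> x \<subseteq> C" shows "alpha_limit \<theta> x \<noteq> {}"
proof -
  have "\<forall>n. \<theta> (- real n) x \<in> C" using assms(2) unfolding neg_orbit_def by force
  then obtain l r where "strict_mono (r :: nat \<Rightarrow> nat)" and l: "((\<lambda>n. \<theta> (- real n) x) \<circ> r) \<longlonglongrightarrow> l"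
    using assms(1) unfolding compact_eq_seq_compact_metric by (metis (lifting) seq_compactE)
  have "filterlim (\<lambda>n. real (r n)) at_top sequentially"
    by (intro filterlim_compose[OF filterlim_real_sequentially] filterlim_subseq \<open>strict_mono r\<close>)
  then have "filterlim (\<lambda>n. - real (r n)) at_bot sequentially"
    by (simp add: filterlim_uminus_at_top)
  with l have "l \<in> alpha_limit \<theta> x" unfolding alpha_limit_def o_def by auto
  then show ?thesis by blast
qed

lemma alpha_limit_subset:
  assumes "closed C" "neg_orbit \<theta> x \<subseteq> C" shows "alpha_limit \<theta> x \<subseteq> C"
proof
  fix y assume "y \<in> alpha_limit \<theta> x"
  then obtain s where s: "filterlim s at_bot sequentially" "(\<lambda>n. \<theta> (s n) x) \<longlonglongrightarrow> y"
    unfolding alpha_limit_def by blast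
  from s(1) have "\<forall>\<^sub>F n in sequentially. s n \<le> 0" unfolding filterlim_at_bot by blast
  then have "\<forall>\<^sub>F n in sequentially. \<theta> (s n) x \<in> C"
    by eventually_elim (use assms(2) in \<open>auto simp: neg_orbit_def\<close>)
  then show "y \<in> C"
    using Lim_in_closed_set[OF \<open>closed C\<close> _ _ s(2)] by simp
qed

lemma alpha_limit_invariant: "flow_invariant \<theta> (alpha_limit \<theta> x)"
  unfolding invariant_iff
proof (intro ballI allI)
  fix y t assume "y \<in> alpha_limit \<theta> x"
  then obtain s where s: "filterlim s at_bot sequentially" "(\<lambda>n. \<theta> (s n) x) \<longlonglongrightarrow> y"
    unfolding alpha_limit_def by blast
  have "filterlim (\<lambda>n. t + s n) at_bot sequentially"
    unfolding filterlim_at_bot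
  proof
    fix Z
    have "\<forall>\<^sub>F n in sequentially. s n \<le> Z - t" using s(1) unfolding filterlim_at_bot by blast
    then show "\<forall>\<^sub>F n in sequentially. t + s n \<le> Z" by eventually_elim auto
  qed
  moreover have "(\<lambda>n. \<theta> (t + s n) x) \<longlonglongrightarrow> \<theta> t y"
    using flow_tendsto[OF tendsto_const s(2), of t] by (simp add: flow_add)
  ultimately show "\<theta> t y \<in> alpha_limit \<theta> x" unfolding alpha_limit_def by blast
qed

lemma neg_orbit_subset_orbit: "neg_orbit \<theta> x \<subseteq> flow_orbit \<theta> x"
  unfolding neg_orbit_def flow_orbit_def by auto

section \<open>Orbits leaving a neighbourhood\<close>

lemma stays_open:
  assumes "open W" shows "open {p. \<forall>t\<in>{0..T}. \<theta> t p \<in> W}"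
unfolding open_subopen[of "{p. \<forall>t\<in>{0..T}. \<theta> t p \<in> W}"]
proof
  fix p assume p: "p \<in> {p. \<forall>t\<in>{0..T}. \<theta> t p \<in> W}"
  let ?W = "(\<lambda>(p, t). \<theta> t p) -` W"
  have "continuous_on UNIV ((\<lambda>(t, x). \<theta> t x) \<circ> prod.swap)"
    by (intro continuous_on_compose continuous_on_subset[OF flow_continuous] continuous_on_swap) auto
  then have "continuous_on UNIV (\<lambda>(p, t). \<theta> t p)" by (simp add: o_def case_prod_unfold)
  then have "open ?W" using assms by (simp add: continuous_on_open_vimage)
  moreover have "{p} \<times> {0..T} \<subseteq> ?W" using p by auto
  ultimately obtain X where "p \<in> X" "open X" "X \<times> {0..T} \<subseteq> ?W"
    using Elementary_Topology.tube_lemma[of "{0..T}" ?W p] by auto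
  then show "\<exists>X. open X \<and> p \<in> X \<and> X \<subseteq> {p. \<forall>t\<in>{0..T}. \<theta> t p \<in> W}" by (intro exI[of _ X]) auto
qed

text \<open>
  Points close to the invariant set \<open>K\<close> need a long time to get out of \<open>V\<close>. Stopping them at the
  moment they first leave the interior of \<open>V\<close> and passing to a limit gives a point outside \<open>K\<close>
  whose whole past lies in \<open>V\<close>. The set \<open>S\<close> allows the construction to stay inside an orbit closure.
\<close>

lemma exit_point:
  assumes K: "flow_invariant \<theta> K" and V: "compact V" "K \<subseteq> interior V" and S: "closed S" "flow_invariant \<theta> S"
    and exit: "\<And>W. open W \<Longrightarrow> K \<subseteq> W \<Longrightarrow> \<exists>p\<in>W \<inter> S. \<exists>t\<ge>0. \<theta> t p \<notin> V"
  obtains z where "z \<in> V \<inter> S - K" "neg_orbit \<theta> z \<subseteq> V"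
proof -
  \<comment> \<open>a point of \<open>W n\<close> cannot exit before time \<open>n\<close>, so the exit times tend to infinity\<close>
  define W where "W n = {p. \<forall>t\<in>{0..real n}. \<theta> t p \<in> interior V}" for n
  have "open (W n)" "K \<subseteq> W n" for n
    unfolding W_def using stays_open[OF open_interior] V(2) invariantD[OF K] by blast+
  then have "\<exists>p. p \<in> W n \<inter> S \<and> (\<exists>t\<ge>0. \<theta> t p \<notin> V)" for n using exit[of "W n"] by blast
  then obtain p where p: "\<And>n. p n \<in> W n \<inter> S" "\<And>n. \<exists>t\<ge>0. \<theta> t (p n) \<notin> V" by metis
  have "\<exists>e. e > real n \<and> \<theta> e (p n) \<notin> interior V \<and> (\<forall>t. 0 \<le> t \<and> t < e \<longrightarrow> \<theta> t (p n) \<in> interior V)" for n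
  proof -
    let ?E = "{0..} \<inter> (\<lambda>t. \<theta> t (p n)) -` (- interior V)"
    have cont: "continuous_on UNIV (\<lambda>t. \<theta> t (p n))"
      unfolding continuous_on_def by (auto intro!: flow_tendsto tendsto_intros)
    have "closed ((\<lambda>t. \<theta> t (p n)) -` (- interior V))"
      by (rule closed_vimage) (auto simp: cont)
    then have cl: "closed ?E" by (intro closed_Int closed_atLeast)
    have ne: "?E \<noteq> {}" using p(2)[of n] interior_subset by fastforce
    have bdd: "bdd_below ?E" by (rule bdd_belowI[of _ 0]) auto
    have I: "Inf ?E \<in> ?E" by (rule closed_contains_Inf[OF ne bdd cl])
    have "\<theta> t (p n) \<in> interior V" if "0 \<le> t" "t < Inf ?E" for t
      using cInf_lower[OF _ bdd, of t] that by force
    moreover have "Inf ?E > real n"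
      using p(1)[of n] I unfolding W_def by (fastforce simp: not_less)
    ultimately show ?thesis using I by blast
  qed
  then obtain e where e: "\<And>n. e n > real n" "\<And>n. \<theta> (e n) (p n) \<notin> interior V"
      "\<And>n t. 0 \<le> t \<Longrightarrow> t < e n \<Longrightarrow> \<theta> t (p n) \<in> interior V"
    by metis
  have "closed V" using V(1) compact_imp_closed by blast
  have inV: "\<theta> (e n) (p n) \<in> V" for n
  proof (rule Lim_in_closed_set[OF \<open>closed V\<close>])
    have pos: "e n > 0" using e(1)[of n] by linarith
    have "((\<lambda>t. \<theta> t (p n)) \<longlongrightarrow> \<theta> (e n) (p n)) (at_left (e n))"
      by (intro flow_tendsto tendsto_intros)
    then show "((\<lambda>t. \<theta> t (p n)) \<longlongrightarrow> \<theta> (e n) (p n)) (at_left (e n))" .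
    have "\<forall>\<^sub>F t in at_left (e n). t \<in> {0<..<e n}" using eventually_at_left_real[OF pos] .
    then show "\<forall>\<^sub>F t in at_left (e n). \<theta> t (p n) \<in> V"
      by eventually_elim (use e(3) interior_subset in force)
  qed simp
  then have "\<forall>n. \<theta> (e n) (p n) \<in> V" by blast
  then obtain z r where "z \<in> V" "strict_mono (r :: nat \<Rightarrow> nat)" and
    z: "((\<lambda>n. \<theta> (e n) (p n)) \<circ> r) \<longlonglongrightarrow> z"
    using V(1) unfolding compact_eq_seq_compact_metric by (metis (lifting) seq_compactE)
  have z': "(\<lambda>n. \<theta> (e (r n)) (p (r n))) \<longlonglongrightarrow> z" using z by (simp add: o_def)
  have "z \<in> S"
    by (rule Lim_in_closed_set[OF S(1) _ _ z']) (use p(1) invariantD[OF S(2)] in auto)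
  moreover have "z \<in> - interior V"
    by (rule Lim_in_closed_set[OF _ _ _ z']) (use e(2) in auto)
  moreover have "\<theta> s z \<in> V" if "s \<le> 0" for s
  proof (rule Lim_in_closed_set[OF \<open>closed V\<close>])
    show "(\<lambda>n. \<theta> s (\<theta> (e (r n)) (p (r n)))) \<longlonglongrightarrow> \<theta> s z" by (intro flow_tendsto z' tendsto_const)
    have "\<forall>\<^sub>F n in sequentially. n \<ge> nat \<lceil>- s\<rceil>" by (rule eventually_ge_at_top)
    then show "\<forall>\<^sub>F n in sequentially. \<theta> s (\<theta> (e (r n)) (p (r n))) \<in> V"
    proof eventually_elim
      case (elim n)
      have "r n \<ge> n" using \<open>strict_mono r\<close> by (rule seq_suble)
      then have "s + e (r n) \<ge> 0" using elim e(1)[of "r n"] by linarith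
      moreover have "s + e (r n) \<le> e (r n)" using that by simp
      ultimately have "\<theta> (s + e (r n)) (p (r n)) \<in> V"
        using e(3)[of "s + e (r n)" "r n"] inV[of "r n"] interior_subset[of V]
        by (cases "s = 0") auto
      then show ?case by (simp add: flow_add)
    qed
  qed simp
  ultimately show thesis
    using that[of z] \<open>z \<in> V\<close> V(2) unfolding neg_orbit_def by blast
qed

section \<open>Orbit closures that are minimal modulo an invariant set\<close>

text \<open>
  Absence of descending sequences makes strict inclusion of orbit closures well-founded on the orbits
  in \<open>C - K\<close>. A minimal orbit \<open>y\<close> below \<open>x\<close> has a closure which is minimal up to what it contains
  of \<open>K\<close>. For \<open>K = {}\<close> this yields genuine minimal sets.
\<close>

lemma minimal_closure_below:
  assumes dcc: "orbit_dcc \<theta> (C - K)" and C: "closed C" and K: "flow_invariant \<theta> K"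
    and x: "flow_orbit \<theta> x \<subseteq> C - K"
  obtains y where "y \<in> closure (flow_orbit \<theta> x)" "flow_orbit \<theta> y \<subseteq> C - K"
    "\<And>z. z \<in> closure (flow_orbit \<theta> y) - K \<Longrightarrow> closure (flow_orbit \<theta> z) = closure (flow_orbit \<theta> y)"
proof -
  let ?cl = "\<lambda>x. closure (flow_orbit \<theta> x)"
  have inv: "flow_invariant \<theta> (?cl x)" for x
    by (intro closure_invariant orbit_invariant)
  define R where "R = {(b, a). flow_orbit \<theta> b \<subseteq> C - K \<and> flow_orbit \<theta> a \<subseteq> C - K \<and> ?cl b \<subset> ?cl a}"
  have "wf R"
    unfolding wf_iff_no_infinite_down_chain
  proof
    assume "\<exists>f. \<forall>i. (f (Suc i), f i) \<in> R"
    then obtain f where "\<And>i. (f (Suc i), f i) \<in> R" by blast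
    then have "\<And>i. flow_orbit \<theta> (f i) \<subseteq> C - K \<and> ?cl (f (Suc i)) \<subset> ?cl (f i)" unfolding R_def by simp
    with dcc show False unfolding orbit_dcc_def by metis
  qed
  define Q where "Q = {w \<in> ?cl x. flow_orbit \<theta> w \<subseteq> C - K}"
  have "x \<in> Q" unfolding Q_def using x closure_subset orbit_self by blast
  obtain y where "y \<in> Q" and minQ: "\<And>b. (b, y) \<in> R \<Longrightarrow> b \<notin> Q"
    by (rule wfE_min[OF \<open>wf R\<close> \<open>x \<in> Q\<close>]) (rule that)
  then have y: "y \<in> ?cl x" "flow_orbit \<theta> y \<subseteq> C - K" unfolding Q_def by auto
  have "?cl z = ?cl y" if z: "z \<in> ?cl y - K" for z
  proof (rule ccontr)
    assume ne: "?cl z \<noteq> ?cl y"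
    have sub: "?cl z \<subseteq> ?cl y" using z by (intro closure_orbit_subset inv) auto
    have "?cl y \<subseteq> C" using y(2) C by (intro closure_minimal) auto
    then have "flow_orbit \<theta> z \<subseteq> C - K"
      using z sub closure_subset[of "flow_orbit \<theta> z"] by (intro orbit_subset_Diff K) auto
    moreover have "?cl y \<subseteq> ?cl x" using y(1) by (intro closure_orbit_subset inv) auto
    ultimately show False
      using minQ[of z] y(2) sub ne z unfolding R_def Q_def by auto
  qed
  with that y show thesis by blast
qed

lemma minimal_set_closure_orbit:
  assumes "\<And>z. z \<in> closure (flow_orbit \<theta> y) \<Longrightarrow> closure (flow_orbit \<theta> z) = closure (flow_orbit \<theta> y)"
  shows "minimal_set \<theta> (closure (flow_orbit \<theta> y))"
  unfolding minimal_set_def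
proof (intro conjI notI)
  assume "\<exists>Y\<subset>closure (flow_orbit \<theta> y). Y \<noteq> {} \<and> closed Y \<and> flow_invariant \<theta> Y"
  then obtain Y z where Y: "Y \<subset> closure (flow_orbit \<theta> y)" "closed Y" "flow_invariant \<theta> Y" "z \<in> Y" by blast
  then have "closure (flow_orbit \<theta> z) \<subseteq> Y" by (intro closure_orbit_subset)
  with Y assms show False by blast
qed (use orbit_self[of y] in \<open>auto intro: closure_invariant orbit_invariant\<close>)

text \<open>
  Let \<open>Z\<close> be the closure of the orbit of \<open>y\<close>, and suppose \<open>\<alpha>(y)\<close> is not contained in \<open>K\<close>. By minimality \<open>y\<close> is
  then negatively recurrent and its past orbit comes arbitrarily close to \<open>K\<close>; each time it has to
  come back to \<open>y\<close>, so it leaves a small neighbourhood \<open>V\<close> of \<open>K\<close>. The exit point \<open>z\<close> has its past in \<open>V\<close>,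
  and \<open>\<alpha>(z)\<close> cannot contain a point off \<open>K\<close>, since the orbit of such a point would be dense in \<open>Z\<close>,
  whereas \<open>V\<close> misses \<open>y\<close>.
\<close>

lemma alpha_asymptotic_in_closure:
  assumes lc: "locally compact (UNIV :: 'a set)" and K: "compact K" "flow_invariant \<theta> K"
    and y: "compact (closure (flow_orbit \<theta> y))" "y \<notin> K"
    and min: "\<And>z. z \<in> closure (flow_orbit \<theta> y) - K \<Longrightarrow> closure (flow_orbit \<theta> z) = closure (flow_orbit \<theta> y)"
    and meets: "closure (flow_orbit \<theta> y) \<inter> K \<noteq> {}"
  obtains x where "x \<notin> K" "alpha_limit \<theta> x \<noteq> {}" "alpha_limit \<theta> x \<subseteq> K"
proof -
  let ?Z = "closure (flow_orbit \<theta> y)"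
  have Z: "flow_invariant \<theta> ?Z" by (intro closure_invariant orbit_invariant)
  have yZ: "y \<in> ?Z" using closure_subset orbit_self by blast
  have alphaZ: "alpha_limit \<theta> z \<noteq> {}" "alpha_limit \<theta> z \<subseteq> ?Z" if "z \<in> ?Z" for z
  proof -
    have "neg_orbit \<theta> z \<subseteq> ?Z"
      using neg_orbit_subset_orbit orbit_subset[OF Z that] by blast
    then show "alpha_limit \<theta> z \<noteq> {}" "alpha_limit \<theta> z \<subseteq> ?Z"
      using alpha_limit_nonempty y(1) alpha_limit_subset closed_closure by blast+
  qed
  show thesis
  proof (cases "alpha_limit \<theta> y \<subseteq> K")
    case True
    then show thesis using that[of y] y(2) alphaZ[OF yZ] by blast
  next
    case False
    then obtain w where w: "w \<in> alpha_limit \<theta> y" "w \<notin> K" by blast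
    then have clw: "closure (flow_orbit \<theta> w) = ?Z" using min alphaZ[OF yZ] by blast
    obtain V where V: "compact V" "K \<subseteq> interior V" "V \<subseteq> - {y}"
      using compact_nbhd_within[OF lc K(1), of "- {y}"] y(2) by auto
    have "closed V" using V(1) by (rule compact_imp_closed)
    \<comment> \<open>the orbit of \<open>w\<close>, and with it the past of \<open>y\<close>, enters every neighbourhood \<open>W\<close> of \<open>K\<close>\<close>
    have exit: "\<exists>p\<in>W \<inter> ?Z. \<exists>t\<ge>0. \<theta> t p \<notin> V" if W: "open W" "K \<subseteq> W" for W
    proof -
      have "W \<inter> closure (flow_orbit \<theta> w) \<noteq> {}" using meets W(2) clw by blast
      then have "W \<inter> flow_orbit \<theta> w \<noteq> {}" using W(1) open_Int_closure_eq_empty by blast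
      then obtain t where t: "\<theta> t w \<in> W" unfolding flow_orbit_def by blast
      then have "\<theta> t w \<in> alpha_limit \<theta> y" using w(1) alpha_limit_invariant invariantD by blast
      then obtain s where s: "filterlim s at_bot sequentially" "(\<lambda>n. \<theta> (s n) y) \<longlonglongrightarrow> \<theta> t w"
        unfolding alpha_limit_def by blast
      have "\<forall>\<^sub>F n in sequentially. s n \<le> 0" using s(1) unfolding filterlim_at_bot by blast
      moreover have "\<forall>\<^sub>F n in sequentially. \<theta> (s n) y \<in> W" using topological_tendstoD[OF s(2) W(1) t] .
      ultimately have "\<forall>\<^sub>F n in sequentially. s n \<le> 0 \<and> \<theta> (s n) y \<in> W" by (rule eventually_conj)
      then obtain n where n: "s n \<le> 0" "\<theta> (s n) y \<in> W" using eventually_happens' sequentially_bot by blast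
      have "\<theta> (- s n) (\<theta> (s n) y) \<notin> V" using V(3) by (auto simp: flow_add)
      moreover have "\<theta> (s n) y \<in> ?Z" using yZ Z invariantD by blast
      ultimately show ?thesis
        using n by (intro bexI[of _ "\<theta> (s n) y"] exI[of _ "- s n"]) auto
    qed
    obtain z where z: "z \<in> V \<inter> ?Z - K" "neg_orbit \<theta> z \<subseteq> V"
      using exit_point[OF K(2) V(1,2) closed_closure Z exit] by blast
    have aV: "alpha_limit \<theta> z \<subseteq> V" using alpha_limit_subset[OF \<open>closed V\<close> z(2)] .
    have "alpha_limit \<theta> z \<subseteq> K"
    proof
      fix u assume u: "u \<in> alpha_limit \<theta> z"
      show "u \<in> K"
      proof (rule ccontr)
        assume "u \<notin> K"
        then have "closure (flow_orbit \<theta> u) = ?Z" using u alphaZ z(1) min by blast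
        moreover have "flow_orbit \<theta> u \<subseteq> V"
          using orbit_subset[OF alpha_limit_invariant u] aV by blast
        then have "closure (flow_orbit \<theta> u) \<subseteq> V" using \<open>closed V\<close> by (simp add: closure_minimal)
        ultimately show False using yZ V(3) by blast
      qed
    qed
    then show thesis using that[of z] z(1) alphaZ by blast
  qed
qed

lemma alpha_asymptotic_of_orbit:
  assumes lc: "locally compact (UNIV :: 'a set)" and K: "compact K" "flow_invariant \<theta> K"
    and C: "compact C" and dcc: "orbit_dcc \<theta> (C - K)"
    and nomin: "\<not> (\<exists>\<Lambda>. compact \<Lambda> \<and> minimal_set \<theta> \<Lambda> \<and> \<Lambda> \<subseteq> C - K)"
    and x: "flow_orbit \<theta> x \<subseteq> C - K"
  obtains z where "z \<notin> K" "alpha_limit \<theta> z \<noteq> {}" "alpha_limit \<theta> z \<subseteq> K"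
proof -
  have "closed C" using C by (rule compact_imp_closed)
  obtain y where y: "flow_orbit \<theta> y \<subseteq> C - K"
    and min: "\<And>z. z \<in> closure (flow_orbit \<theta> y) - K \<Longrightarrow> closure (flow_orbit \<theta> z) = closure (flow_orbit \<theta> y)"
    using minimal_closure_below[OF dcc \<open>closed C\<close> K(2) x] by metis
  have sub: "closure (flow_orbit \<theta> y) \<subseteq> C" using y \<open>closed C\<close> by (intro closure_minimal) auto
  have comp: "compact (closure (flow_orbit \<theta> y))"
    using compact_Int_closed[OF C closed_closure, of "flow_orbit \<theta> y"] sub by (simp add: Int_absorb1)
  have "closure (flow_orbit \<theta> y) \<inter> K \<noteq> {}"
  proof
    assume disj: "closure (flow_orbit \<theta> y) \<inter> K = {}"
    then have "minimal_set \<theta> (closure (flow_orbit \<theta> y))"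
      using min by (intro minimal_set_closure_orbit) blast
    with nomin comp sub disj show False by blast
  qed
  moreover have "y \<notin> K" using y orbit_self by blast
  ultimately show thesis
    using alpha_asymptotic_in_closure[OF lc K comp _ min] that by blast
qed

section \<open>Minimal sets near a set that is not tame\<close>

text \<open>
  If \<open>K\<close> is not stable, points near \<open>K\<close> escape, and the exit point \<open>z\<close> either has \<open>\<alpha>(z)\<close> in \<open>K\<close> or
  produces an orbit in \<open>C - K\<close>. If \<open>K\<close> is stable but its basin is not a neighbourhood, some
  \<open>\<omega>\<close>-limit set near \<open>K\<close> produces such an orbit. In the absence of minimal sets an orbit in \<open>C - K\<close>
  has a closure meeting \<open>K\<close> below it, and \<open>alpha_asymptotic_in_closure\<close> applies there.
\<close>

lemma alpha_asymptotic_of_not_attractor: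
  assumes lc: "locally compact (UNIV :: 'a set)" and K: "compact K" "flow_invariant \<theta> K"
    and C: "compact C" "K \<subseteq> interior C" and dcc: "orbit_dcc \<theta> (C - K)"
    and nomin: "\<not> (\<exists>\<Lambda>. compact \<Lambda> \<and> minimal_set \<theta> \<Lambda> \<and> \<Lambda> \<subseteq> C - K)"
    and na: "\<not> attractor \<theta> K"
  obtains z where "z \<notin> K" "alpha_limit \<theta> z \<noteq> {}" "alpha_limit \<theta> z \<subseteq> K"
proof (cases "flow_stable \<theta> K")
  case False
  then obtain U where U: "nbhd U K" "\<And>V. nbhd V K \<Longrightarrow> \<not> (\<Union>x\<in>V. pos_orbit \<theta> x) \<subseteq> U"
    unfolding flow_stable_def by blast
  obtain V where V: "compact V" "K \<subseteq> interior V" "V \<subseteq> interior U \<inter> interior C"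
    using compact_nbhd_within[OF lc K(1), of "interior U \<inter> interior C"] U(1) C(2) unfolding nbhd_def by auto
  have exit: "\<exists>p\<in>W \<inter> UNIV. \<exists>t\<ge>0. \<theta> t p \<notin> V" if "open W" "K \<subseteq> W" for W
  proof -
    have "\<not> (\<Union>x\<in>W. pos_orbit \<theta> x) \<subseteq> U" using U(2) that unfolding nbhd_def by (simp add: interior_open)
    then show ?thesis using V(3) interior_subset[of U] unfolding pos_orbit_def by blast
  qed
  obtain z where z: "z \<in> V \<inter> UNIV - K" "neg_orbit \<theta> z \<subseteq> V"
    using exit_point[OF K(2) V(1,2) closed_UNIV _ exit] invariant_iff by blast
  have aV: "alpha_limit \<theta> z \<subseteq> V" "alpha_limit \<theta> z \<noteq> {}"
    using alpha_limit_subset[OF compact_imp_closed[OF V(1)] z(2)] alpha_limit_nonempty[OF V(1) z(2)] .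
  show thesis
  proof (cases "alpha_limit \<theta> z \<subseteq> K")
    case True
    then show thesis using that z(1) aV by blast
  next
    case False
    then obtain w where w: "w \<in> alpha_limit \<theta> z" "w \<notin> K" by blast
    have "flow_orbit \<theta> w \<subseteq> C"
      using orbit_subset[OF alpha_limit_invariant w(1)] aV(1) V(3) interior_subset[of C] by blast
    then have "flow_orbit \<theta> w \<subseteq> C - K" using orbit_subset_Diff K(2) w(2) by blast
    then show thesis using alpha_asymptotic_of_orbit[OF lc K C(1) dcc nomin] that by blast
  qed
next
  case True
  interpret rev: metric_flow "\<lambda>t. \<theta> (- t)" by (rule reversed)
  have "nbhd C K" using C(2) unfolding nbhd_def .
  then obtain V where V: "nbhd V K" "(\<Union>x\<in>V. pos_orbit \<theta> x) \<subseteq> C"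
    using True unfolding flow_stable_def by blast
  have "\<not> interior V \<subseteq> basin_pos \<theta> K"
  proof
    assume "interior V \<subseteq> basin_pos \<theta> K"
    then have "nbhd (basin_pos \<theta> K) K"
      using V(1) interior_maximal[OF _ open_interior] unfolding nbhd_def by blast
    with na True show False unfolding attractor_def by blast
  qed
  then obtain x where x: "x \<in> V" "x \<notin> basin_pos \<theta> K" using interior_subset by blast
  then have px: "pos_orbit \<theta> x \<subseteq> C" using V(2) by blast
  have "omega_limit \<theta> x \<noteq> {}" "omega_limit \<theta> x \<subseteq> C"
    using rev.alpha_limit_nonempty[OF C(1), of x] rev.alpha_limit_subset[OF compact_imp_closed[OF C(1)], of x] px
    unfolding alpha_reverse neg_orbit_reverse by auto
  moreover have "flow_invariant \<theta> (omega_limit \<theta> x)"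
    using rev.alpha_limit_invariant[of x] unfolding alpha_reverse invariant_reverse .
  moreover obtain w where "w \<in> omega_limit \<theta> x" "w \<notin> K"
    using x(2) calculation(1) unfolding basin_pos_def by blast
  ultimately have "flow_orbit \<theta> w \<subseteq> C - K"
    using orbit_subset[of "omega_limit \<theta> x" w] orbit_subset_Diff[OF K(2)] by blast
  then show thesis using alpha_asymptotic_of_orbit[OF lc K C(1) dcc nomin] that by blast
qed

text \<open>
  Without a minimal set in \<open>C - K\<close> the set \<open>K\<close> would be isolated from minimal sets, and it would be
  stagnant: as it is not an attractor it has an orbit \<open>\<alpha>\<close>-asymptotic to it, and as it is not a
  repeller the reversed flow gives one that is \<open>\<omega>\<close>-asymptotic to it.
\<close>

lemma minimal_set_near_of_not_tame:
  assumes lc: "locally compact (UNIV :: 'a set)" and K: "compact K" "flow_invariant \<theta> K"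
    and C: "compact C" "K \<subseteq> interior C" and dcc: "orbit_dcc \<theta> (C - K)" and nt: "\<not> tame \<theta> K"
  obtains \<Lambda> where "compact \<Lambda>" "minimal_set \<theta> \<Lambda>" "\<Lambda> \<subseteq> C - K"
proof (rule ccontr)
  assume "\<not> thesis"
  with that have nomin: "\<not> (\<exists>\<Lambda>. compact \<Lambda> \<and> minimal_set \<theta> \<Lambda> \<and> \<Lambda> \<subseteq> C - K)" by blast
  interpret rev: metric_flow "\<lambda>t. \<theta> (- t)" by (rule reversed)
  obtain x where x: "x \<notin> K" "alpha_limit \<theta> x \<noteq> {}" "alpha_limit \<theta> x \<subseteq> K"
    using alpha_asymptotic_of_not_attractor[OF lc K C dcc nomin] nt unfolding tame_def by blast
  obtain y where y: "y \<notin> K" "omega_limit \<theta> y \<noteq> {}" "omega_limit \<theta> y \<subseteq> K"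
    using rev.alpha_asymptotic_of_not_attractor[OF lc K(1) _ C] K(2) dcc nomin nt
    unfolding tame_def attractor_reverse alpha_reverse invariant_reverse orbit_dcc_reverse minimal_reverse
    by blast
  have "stagnant \<theta> K" unfolding stagnant_def using x y by blast
  moreover have "isolated_from_minimal_sets \<theta> K"
    unfolding isolated_from_minimal_sets_def
  proof (intro exI[of _ C] conjI notI)
    show "nbhd C K" using C(2) unfolding nbhd_def .
    assume "\<exists>\<Lambda>. minimal_set \<theta> \<Lambda> \<and> \<Lambda> \<subseteq> C - K"
    then obtain \<Lambda> where L: "minimal_set \<theta> \<Lambda>" "\<Lambda> \<subseteq> C - K" by blast
    then have "compact \<Lambda>"
      using compact_Int_closed[OF C(1), of \<Lambda>] unfolding minimal_set_def by (metis Diff_subset Int_absorb1 subset_trans)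
    with L nomin show False by blast
  qed
  ultimately show False using nt unfolding tame_def by blast
qed

section \<open>A Cantor scheme of minimal sets\<close>

text \<open>
  If every minimal set in \<open>N\<close> is approached by others, disjoint compact neighbourhoods of distinct
  minimal sets can be split again and again, giving a binary tree of compact sets. A limit of minimal
  sets need not be minimal, but the intersection along a branch still contains a whole orbit, hence a
  minimal set, and different branches have disjoint intersections.
\<close>

lemma continuum_of_minimal_sets:
  assumes lc: "locally compact (UNIV :: 'a set)" and N: "open N" and dcc: "orbit_dcc \<theta> N"
    and ne: "compact_minimal_sets_in \<theta> N \<noteq> {}"
    and perfect: "\<And>\<Lambda> W. \<Lambda> \<in> compact_minimal_sets_in \<theta> N \<Longrightarrow> open W \<Longrightarrow> \<Lambda> \<subseteq> W \<Longrightarrow>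
        \<exists>\<Lambda>'. \<Lambda>' \<in> compact_minimal_sets_in \<theta> (N \<inter> W) \<and> \<Lambda>' \<noteq> \<Lambda>"
  shows "(UNIV :: real set) \<lesssim> compact_minimal_sets_in \<theta> N"
proof -
  \<comment> \<open>nodes of the tree: compact sets with a minimal set in the interior, so that they can be split\<close>
  define G where "G C \<longleftrightarrow> compact C \<and> C \<subseteq> N \<and> compact_minimal_sets_in \<theta> (interior C) \<noteq> {}" for C
  have "\<exists>D. G D \<and> D \<subseteq> W" if L: "\<Lambda> \<in> compact_minimal_sets_in \<theta> N" and W: "open W" "\<Lambda> \<subseteq> W" for \<Lambda> W
  proof -
    have "compact \<Lambda>" "minimal_set \<theta> \<Lambda>" "\<Lambda> \<subseteq> N" using L unfolding compact_minimal_sets_in_def by auto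
    moreover obtain D where "compact D" "\<Lambda> \<subseteq> interior D" "D \<subseteq> N \<inter> W"
      using compact_nbhd_within[OF lc \<open>compact \<Lambda>\<close>, of "N \<inter> W"] N W \<open>\<Lambda> \<subseteq> N\<close> by auto
    ultimately show ?thesis unfolding G_def compact_minimal_sets_in_def by blast
  qed
  note nb = this
  have "\<exists>D E. G D \<and> G E \<and> D \<subseteq> C \<and> E \<subseteq> C \<and> D \<inter> E = {}" if C: "G C" for C
  proof -
    obtain \<Lambda> where L: "compact \<Lambda>" "minimal_set \<theta> \<Lambda>" "\<Lambda> \<subseteq> interior C" "\<Lambda> \<subseteq> N"
      using C interior_subset unfolding G_def compact_minimal_sets_in_def by blast
    then have LN: "\<Lambda> \<in> compact_minimal_sets_in \<theta> N" unfolding compact_minimal_sets_in_def by blast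
    obtain \<Lambda>' where L': "\<Lambda>' \<in> compact_minimal_sets_in \<theta> (N \<inter> interior C)" "\<Lambda>' \<noteq> \<Lambda>"
      using perfect[OF LN open_interior L(3)] by blast
    then have LN': "\<Lambda>' \<in> compact_minimal_sets_in \<theta> N" "\<Lambda>' \<subseteq> interior C" "compact \<Lambda>'" "minimal_set \<theta> \<Lambda>'"
      unfolding compact_minimal_sets_in_def by auto
    have "\<Lambda> \<inter> \<Lambda>' = {}" using minimal_sets_disjoint L(2) LN'(4) L'(2) by blast
    then obtain A B where AB: "open A" "open B" "\<Lambda> \<subseteq> A" "\<Lambda>' \<subseteq> B" "A \<inter> B = {}"
      using t4_space[of \<Lambda> \<Lambda>'] compact_imp_closed[OF L(1)] compact_imp_closed[OF LN'(3)] by blast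
    obtain D where "G D" "D \<subseteq> A \<inter> interior C" using nb[OF LN, of "A \<inter> interior C"] AB L(3) by auto
    moreover obtain E where "G E" "E \<subseteq> B \<inter> interior C" using nb[OF LN'(1), of "B \<inter> interior C"] AB LN'(2) by auto
    ultimately show ?thesis using AB(5) interior_subset[of C] by blast
  qed
  then obtain f0 f1 where f: "\<And>C. G C \<Longrightarrow> G (f0 C) \<and> G (f1 C) \<and> f0 C \<subseteq> C \<and> f1 C \<subseteq> C \<and> f0 C \<inter> f1 C = {}"
    by metis
  obtain C0 where C0: "G C0" using nb[of _ N] ne N unfolding compact_minimal_sets_in_def by blast
  \<comment> \<open>a branch is a set \<open>S\<close> of levels, those where the second child is taken\<close>
  define B where "B S = rec_nat C0 (\<lambda>n C. if n \<in> S then f1 C else f0 C)" for S :: "nat set"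
  have B0: "B S 0 = C0" and BS: "B S (Suc n) = (if n \<in> S then f1 (B S n) else f0 (B S n))" for S n
    unfolding B_def by auto
  have GB: "G (B S n)" for S n by (induction n) (use C0 f in \<open>auto simp: B0 BS\<close>)
  have dec: "B S n \<subseteq> B S m" if "m \<le> n" for S m n
    by (rule lift_Suc_antimono_le[of "B S", OF _ that]) (use f[OF GB] in \<open>simp add: BS\<close>)
  have cB: "closed (B S n)" for S n using GB compact_imp_closed unfolding G_def by blast
  have "\<exists>\<Lambda>. \<Lambda> \<in> compact_minimal_sets_in \<theta> N \<and> \<Lambda> \<subseteq> (\<Inter>n. B S n)" for S
  proof -
    have "\<exists>x. flow_orbit \<theta> x \<subseteq> B S n" for n
    proof -
      obtain \<Lambda> where L: "minimal_set \<theta> \<Lambda>" "\<Lambda> \<subseteq> interior (B S n)"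
        using GB[of S n] unfolding G_def compact_minimal_sets_in_def by blast
      then obtain x where "x \<in> \<Lambda>" unfolding minimal_set_def by blast
      then have "flow_orbit \<theta> x \<subseteq> \<Lambda>" using L(1) orbit_subset unfolding minimal_set_def by blast
      then show ?thesis using L(2) interior_subset by blast
    qed
    then obtain x where x: "\<And>n. flow_orbit \<theta> (x n) \<subseteq> B S n" by metis
    then have "\<forall>n. x n \<in> C0" using dec[of 0 _ S] B0 orbit_self by blast
    moreover have "compact C0" "C0 \<subseteq> N" using C0 unfolding G_def by auto
    ultimately obtain l r where lr: "strict_mono (r :: nat \<Rightarrow> nat)" "(x \<circ> r) \<longlonglongrightarrow> l"
      unfolding compact_eq_seq_compact_metric by (metis seq_compactE)
    have orb: "flow_orbit \<theta> l \<subseteq> B S m" for m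
    proof
      fix u assume "u \<in> flow_orbit \<theta> l"
      then obtain t where u: "u = \<theta> t l" unfolding flow_orbit_def by blast
      have lim: "(\<lambda>n. \<theta> t (x (r n))) \<longlonglongrightarrow> u" unfolding u using lr(2) by (intro flow_tendsto) (auto simp: o_def)
      have "\<forall>\<^sub>F n in sequentially. \<theta> t (x (r n)) \<in> B S m"
        using eventually_ge_at_top[of m]
      proof eventually_elim
        case (elim n)
        then have "r n \<ge> m" using seq_suble[OF lr(1), of n] by linarith
        then show ?case using x[of "r n"] dec[of m "r n" S] orbit_step[of t "x (r n)"] by blast
      qed
      then show "u \<in> B S m" using Lim_in_closed_set[OF cB _ _ lim] by simp
    qed
    have "orbit_dcc \<theta> (C0 - {})" using orbit_dcc_mono[OF dcc] \<open>C0 \<subseteq> N\<close> by simp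
    moreover have "flow_orbit \<theta> l \<subseteq> C0 - {}" using orb[of 0] B0 by simp
    ultimately obtain y where y: "y \<in> closure (flow_orbit \<theta> l)"
      and min: "\<And>z. z \<in> closure (flow_orbit \<theta> y) - {} \<Longrightarrow> closure (flow_orbit \<theta> z) = closure (flow_orbit \<theta> y)"
      using minimal_closure_below[of C0 "{}" l] compact_imp_closed[OF \<open>compact C0\<close>] invariant_iff by (metis empty_iff)
    have "closure (flow_orbit \<theta> y) \<subseteq> closure (flow_orbit \<theta> l)"
      using y by (intro closure_orbit_subset closure_invariant orbit_invariant) auto
    moreover have "closure (flow_orbit \<theta> l) \<subseteq> B S m" for m using orb cB by (intro closure_minimal)
    ultimately have sub: "closure (flow_orbit \<theta> y) \<subseteq> (\<Inter>n. B S n)" by blast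
    then have "closure (flow_orbit \<theta> y) \<subseteq> C0" using B0 by blast
    then have "compact (closure (flow_orbit \<theta> y))"
      using compact_Int_closed[OF \<open>compact C0\<close> closed_closure, of "flow_orbit \<theta> y"] by (simp add: Int_absorb1)
    moreover have "minimal_set \<theta> (closure (flow_orbit \<theta> y))"
      using min by (intro minimal_set_closure_orbit) simp
    ultimately show ?thesis
      using sub \<open>closure (flow_orbit \<theta> y) \<subseteq> C0\<close> \<open>C0 \<subseteq> N\<close> unfolding compact_minimal_sets_in_def by blast
  qed
  then obtain M where M: "\<And>S. M S \<in> compact_minimal_sets_in \<theta> N" "\<And>S. M S \<subseteq> (\<Inter>n. B S n)" by metis
  have "inj M"
  proof (rule injI, rule ccontr)
    fix S T assume eq: "M S = M T" and "S \<noteq> T"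
    then have ex: "\<exists>n. (n \<in> S) \<noteq> (n \<in> T)" by blast
    define n where "n = (LEAST n. (n \<in> S) \<noteq> (n \<in> T))"
    have n: "(n \<in> S) \<noteq> (n \<in> T)" unfolding n_def using ex by (rule LeastI_ex)
    have less: "(i \<in> S) = (i \<in> T)" if "i < n" for i using not_less_Least that unfolding n_def by blast
    have "B S i = B T i" if "i \<le> n" for i using that
      by (induction i) (auto simp: B0 BS less)
    then have "B S (Suc n) \<inter> B T (Suc n) = {}" using n f[OF GB[of S n]] by (auto simp: BS)
    moreover have "M S \<subseteq> B S (Suc n)" "M S \<subseteq> B T (Suc n)" using M(2)[of S] M(2)[of T] eq by blast+
    moreover have "M S \<noteq> {}" using M(1)[of S] unfolding compact_minimal_sets_in_def minimal_set_def by blast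
    ultimately show False by blast
  qed
  then have "(UNIV :: nat set set) \<lesssim> compact_minimal_sets_in \<theta> N"
    unfolding lepoll_def using M(1) by blast
  then show ?thesis using nat_sets_eqpoll_reals lepoll_trans1 eqpoll_sym by blast
qed

end

section \<open>Limits in the Hausdorff metric\<close>

lemma exists_dist_less:
  assumes "A \<noteq> {}" "infdist x A < e" obtains a where "a \<in> A" "dist x a < e"
proof -
  have "bdd_below ((\<lambda>a. dist x a) ` A)" by (rule bdd_belowI[of _ 0]) auto
  then show thesis
    using assms that unfolding infdist_notempty[OF assms(1)] by (auto simp: cINF_less_iff)
qed

lemma hausdorff_dist_commute: "hausdorff_dist A B = hausdorff_dist B A"
  unfolding hausdorff_dist_def by (rule max.commute)

lemma hausdorff_dist_le:
  assumes "A \<noteq> {}" "B \<noteq> {}" "\<And>a. a \<in> A \<Longrightarrow> infdist a B \<le> e" "\<And>b. b \<in> B \<Longrightarrow> infdist b A \<le> e"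
  shows "hausdorff_dist A B \<le> e"
  unfolding hausdorff_dist_def using assms by (auto intro!: cSUP_least)

lemma infdist_le_hausdorff_dist:
  assumes "bounded A" "a \<in> A" "B \<noteq> {}" shows "infdist a B \<le> hausdorff_dist A B"
proof -
  obtain b where "b \<in> B" using assms(3) by blast
  obtain M where M: "\<And>x. x \<in> A \<Longrightarrow> dist b x \<le> M" using assms(1) bounded_any_center[of A b] by blast
  have "bdd_above ((\<lambda>x. infdist x B) ` A)"
    using infdist_le2[OF \<open>b \<in> B\<close>] M by (intro bdd_aboveI[of _ M]) (auto simp: dist_commute)
  then have "infdist a B \<le> (SUP x\<in>A. infdist x B)" by (rule cSUP_upper[OF assms(2)])
  then show ?thesis unfolding hausdorff_dist_def by linarith
qed

lemma infdist_le_hausdorff_dist':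
  assumes "bounded B" "b \<in> B" "A \<noteq> {}" shows "infdist b A \<le> hausdorff_dist A B"
  using infdist_le_hausdorff_dist[OF assms] by (simp add: hausdorff_dist_commute)

text \<open>
  The sequences of distances from \<open>L n\<close> to the points of \<open>D\<close> lie in a countable product of compact
  intervals.
\<close>

lemma infdist_convergent_subsequence:
  fixes C :: "'a::metric_space set"
  assumes C: "compact C" and L: "\<And>n::nat. L n \<noteq> {}" "\<And>n. L n \<subseteq> C" and D: "countable D"
  obtains r g where "strict_mono (r :: nat \<Rightarrow> nat)" "\<And>c. c \<in> D \<Longrightarrow> (\<lambda>n. infdist c (L (r n))) \<longlonglongrightarrow> g c"
proof (cases "D = {}")
  case True
  then show thesis using that[of id] strict_mono_id by blast
next
  case False
  let ?d = "from_nat_into D"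
  have "\<exists>M. \<forall>y\<in>C. dist (?d i) y \<le> M" for i
    using compact_imp_bounded[OF C] bounded_any_center[of C "?d i"] by blast
  then obtain M where M: "\<And>i y. y \<in> C \<Longrightarrow> dist (?d i) y \<le> M i" by metis
  define f where "f n = (\<lambda>i. infdist (?d i) (L n))" for n
  have "f n \<in> (\<Pi>\<^sub>E i\<in>UNIV. {0..M i})" for n
  proof -
    obtain y where "y \<in> L n" using L(1) by blast
    then have "infdist (?d i) (L n) \<le> M i" for i using infdist_le2 M L(2) by blast
    then show ?thesis unfolding f_def by (auto simp: infdist_nonneg)
  qed
  then have "\<forall>n. f n \<in> (\<Pi>\<^sub>E i\<in>UNIV. {0..M i})" by blast
  moreover have "compact (\<Pi>\<^sub>E i\<in>(UNIV :: nat set). {0..M i})"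
    using compactin_PiE[of "\<lambda>_. euclidean" UNIV "\<lambda>i. {0..M i}"] unfolding euclidean_product_topology by simp
  ultimately obtain l r where "strict_mono (r :: nat \<Rightarrow> nat)" and l: "(f \<circ> r) \<longlonglongrightarrow> l"
    unfolding compact_eq_seq_compact_metric by (metis seq_compactE)
  have "(\<lambda>n. (f \<circ> r) n i) \<longlonglongrightarrow> l i" for i
    by (rule continuous_on_tendsto_compose[OF continuous_on_product_coordinates l]) auto
  then have lim: "(\<lambda>n. infdist (?d i) (L (r n))) \<longlonglongrightarrow> l i" for i unfolding f_def o_def .
  have "(\<lambda>n. infdist c (L (r n))) \<longlonglongrightarrow> l (to_nat_on D c)" if "c \<in> D" for c
    using lim[of "to_nat_on D c"] that D by simp
  then show thesis using that[OF \<open>strict_mono r\<close>, of "\<lambda>c. l (to_nat_on D c)"] by blast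
qed

text \<open>
  Blaschke's selection theorem. Distance functions of sets are 1-Lipschitz, so their convergence at
  the centres of finite covers of \<open>C\<close> makes the subsequence uniformly Cauchy in Hausdorff distance.
  The limit consists of the points whose distance to \<open>L (r n)\<close> tends to 0.
\<close>

lemma hausdorff_convergent_subsequence:
  fixes C :: "'a::metric_space set"
  assumes C: "compact C" and L: "\<And>n::nat. L n \<noteq> {}" "\<And>n. L n \<subseteq> C"
  obtains Q r where "strict_mono (r :: nat \<Rightarrow> nat)" "compact Q" "Q \<noteq> {}" "Q \<subseteq> C"
    "(\<lambda>n. hausdorff_dist (L (r n)) Q) \<longlonglongrightarrow> 0"
proof -
  have "\<exists>D. finite D \<and> C \<subseteq> (\<Union>c\<in>D. ball c (inverse (real (Suc k))))" for k
    using C unfolding compact_eq_totally_bounded by (metis inverse_positive_iff_positive of_nat_0_less_iff zero_less_Suc)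
  then obtain D where D: "\<And>k. finite (D k)" "\<And>k. C \<subseteq> (\<Union>c\<in>D k. ball c (inverse (real (Suc k))))" by metis
  have "countable (\<Union>k. D k)" using D(1) by (auto intro: countable_finite)
  then obtain r g where r: "strict_mono (r :: nat \<Rightarrow> nat)"
      and g: "\<And>c. c \<in> (\<Union>k. D k) \<Longrightarrow> (\<lambda>n. infdist c (L (r n))) \<longlonglongrightarrow> g c"
    using infdist_convergent_subsequence[of C L, OF C L] by metis
  let ?L = "\<lambda>n. L (r n)"
  have cauchy: "\<exists>N. \<forall>m\<ge>N. \<forall>n\<ge>N. \<forall>x\<in>?L n. infdist x (?L m) < e" if "e > 0" for e
  proof -
    obtain k where k: "inverse (real (Suc k)) < e / 4" using reals_Archimedean[of "e / 4"] \<open>e > 0\<close> by auto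
    have "\<forall>\<^sub>F n in sequentially. \<forall>c\<in>D k. dist (infdist c (?L n)) (g c) < e / 4"
      using D(1) g \<open>e > 0\<close> by (intro eventually_ball_finite ballI tendstoD) auto
    then obtain N where N: "\<And>n c. n \<ge> N \<Longrightarrow> c \<in> D k \<Longrightarrow> dist (infdist c (?L n)) (g c) < e / 4"
      unfolding eventually_sequentially by blast
    have "infdist x (?L m) < e" if "m \<ge> N" "n \<ge> N" "x \<in> ?L n" for m n x
    proof -
      obtain c where c: "c \<in> D k" "dist c x < e / 4" using D(2)[of k] L(2)[of "r n"] \<open>x \<in> ?L n\<close> k by fastforce
      have "infdist c (?L n) \<le> dist c x" using \<open>x \<in> ?L n\<close> by (rule infdist_le)
      moreover have "infdist x (?L m) \<le> infdist c (?L m) + dist x c" by (rule infdist_triangle)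
      ultimately show ?thesis
        using c(2) N[OF \<open>n \<ge> N\<close> c(1)] N[OF \<open>m \<ge> N\<close> c(1)] unfolding dist_real_def dist_commute[of x c] by linarith
    qed
    then show ?thesis by blast
  qed
  define Q where "Q = {q \<in> C. (\<lambda>n. infdist q (?L n)) \<longlonglongrightarrow> 0}"
  have QI: "q \<in> Q" if "q \<in> C" "\<And>e. e > 0 \<Longrightarrow> \<exists>N. \<forall>n\<ge>N. infdist q (?L n) < e" for q
    unfolding Q_def using that by (auto simp: LIMSEQ_iff infdist_nonneg)
  have QD: "\<exists>N. \<forall>n\<ge>N. infdist q (?L n) < e" if "q \<in> Q" "e > 0" for q e
    using that unfolding Q_def by (auto simp: LIMSEQ_iff infdist_nonneg)
  have near: "\<exists>q\<in>Q. dist x q \<le> e" if N: "\<forall>m\<ge>N. infdist x (?L m) < e" for x e N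
  proof -
    have "\<exists>y. y \<in> ?L (N + m) \<and> dist x y < e" for m
      using exists_dist_less[OF L(1)] N le_add1 by metis
    then obtain y where y: "\<And>m. y m \<in> ?L (N + m)" "\<And>m. dist x (y m) < e" by metis
    then have "\<forall>m. y m \<in> C" using L(2) by blast
    then obtain q s where q: "q \<in> C" "strict_mono (s :: nat \<Rightarrow> nat)" "(y \<circ> s) \<longlonglongrightarrow> q"
      using C unfolding compact_eq_seq_compact_metric by (metis seq_compactE)
    have "dist x q \<le> e"
    proof (rule LIMSEQ_le_const2)
      show "(\<lambda>j. dist x ((y \<circ> s) j)) \<longlonglongrightarrow> dist x q" by (intro tendsto_intros q)
      show "\<exists>N. \<forall>n\<ge>N. dist x ((y \<circ> s) n) \<le> e" using y(2) by (auto intro: less_imp_le)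
    qed
    moreover have "q \<in> Q"
    proof (rule QI[OF q(1)])
      fix d :: real assume "d > 0"
      then obtain N' where N': "\<And>m n z. m \<ge> N' \<Longrightarrow> n \<ge> N' \<Longrightarrow> z \<in> ?L n \<Longrightarrow> infdist z (?L m) < d / 2"
        using cauchy[of "d / 2"] by auto
      obtain J where J: "\<And>j. j \<ge> J \<Longrightarrow> dist (y (s j)) q < d / 2"
        using q(3) \<open>d > 0\<close> unfolding lim_sequentially o_def by (metis half_gt_zero)
      define j where "j = max J N'"
      have "N + s j \<ge> N'" using seq_suble[OF q(2), of j] unfolding j_def by simp
      then have "infdist (y (s j)) (?L m) < d / 2" if "m \<ge> N'" for m using N' y(1) that by blast
      moreover have "dist q (y (s j)) < d / 2" using J[of j] unfolding j_def by (simp add: dist_commute)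
      ultimately have "infdist q (?L m) < d" if "m \<ge> N'" for m
        using infdist_triangle[of q "?L m" "y (s j)"] that by fastforce
      then show "\<exists>N. \<forall>n\<ge>N. infdist q (?L n) < d" by blast
    qed
    ultimately show ?thesis by blast
  qed
  have "Q \<noteq> {}"
  proof -
    obtain N where N: "\<forall>m\<ge>N. \<forall>n\<ge>N. \<forall>x\<in>?L n. infdist x (?L m) < 1" using cauchy[of 1] by auto
    obtain x where "x \<in> ?L N" using L(1) by blast
    then show ?thesis using near[of N x 1] N by blast
  qed
  have "closed Q"
  proof -
    have "q \<in> Q" if q: "q \<in> closure Q" for q
    proof (rule QI)
      have "closure Q \<subseteq> C" using compact_imp_closed[OF C] unfolding Q_def by (intro closure_minimal) auto
      then show "q \<in> C" using q by blast
      fix e :: real assume "e > 0"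
      then obtain p where p: "p \<in> Q" "dist p q < e / 2" using q unfolding closure_approachable by (meson half_gt_zero)
      obtain N where N: "\<And>n. n \<ge> N \<Longrightarrow> infdist p (?L n) < e / 2" using QD[OF p(1), of "e / 2"] \<open>e > 0\<close> by auto
      have "infdist q (?L n) < e" if "n \<ge> N" for n
        using infdist_triangle[of q "?L n" p] p(2) N[OF that] by (simp add: dist_commute)
      then show "\<exists>N. \<forall>n\<ge>N. infdist q (?L n) < e" by blast
    qed
    then show ?thesis using closure_subset_eq by blast
  qed
  moreover have "Q \<subseteq> C" unfolding Q_def by blast
  ultimately have "compact Q" using compact_Int_closed[OF C, of Q] by (simp add: Int_absorb1)
  have "(\<lambda>n. hausdorff_dist (?L n) Q) \<longlonglongrightarrow> 0"
    unfolding LIMSEQ_iff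
  proof (intro allI impI)
    fix e :: real assume "e > 0"
    then obtain N where N: "\<And>m n x. m \<ge> N \<Longrightarrow> n \<ge> N \<Longrightarrow> x \<in> ?L n \<Longrightarrow> infdist x (?L m) < e / 4"
      using cauchy[of "e / 4"] by auto
    have "norm (hausdorff_dist (?L n) Q - 0) < e" if n: "n \<ge> N" for n
    proof -
      have "hausdorff_dist (?L n) Q \<le> e / 2"
      proof (rule hausdorff_dist_le[OF L(1) \<open>Q \<noteq> {}\<close>])
        fix x assume "x \<in> ?L n"
        then obtain q where "q \<in> Q" "dist x q \<le> e / 4" using near[of N x "e / 4"] N n by blast
        then show "infdist x Q \<le> e / 2" using infdist_le2[of q Q x "e / 2"] \<open>e > 0\<close> by simp
      next
        fix q assume "q \<in> Q"
        then obtain N' where N': "\<And>n. n \<ge> N' \<Longrightarrow> infdist q (?L n) < e / 4" using QD[of q "e / 4"] \<open>e > 0\<close> by auto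
        let ?m = "max N N'"
        obtain y where y: "y \<in> ?L ?m" "dist q y < e / 4" using exists_dist_less[OF L(1) N'[of ?m]] by auto
        have "infdist y (?L n) < e / 4" using N[of n ?m y] n y(1) by simp
        then show "infdist q (?L n) \<le> e / 2" using infdist_triangle[of q "?L n" y] y(2) by linarith
      qed
      moreover have "0 \<le> hausdorff_dist (?L n) Q"
      proof -
        obtain q where "q \<in> Q" using \<open>Q \<noteq> {}\<close> by blast
        then show ?thesis
          using infdist_le_hausdorff_dist'[OF compact_imp_bounded[OF \<open>compact Q\<close>] _ L(1)] infdist_nonneg order_trans by metis
      qed
      ultimately show ?thesis using \<open>e > 0\<close> by simp
    qed
    then show "\<exists>N. \<forall>n\<ge>N. norm (hausdorff_dist (?L n) Q - 0) < e" by blast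
  qed
  then show thesis using that r \<open>compact Q\<close> \<open>Q \<noteq> {}\<close> \<open>Q \<subseteq> C\<close> by blast
qed

lemma hausdorff_limit_point:
  assumes lim: "(\<lambda>n. hausdorff_dist (L n) Q) \<longlonglongrightarrow> 0" and L: "\<And>n. L n \<noteq> {}" and Q: "compact Q" "q \<in> Q"
  obtains f where "\<And>n. f n \<in> L n" "f \<longlonglongrightarrow> q"
proof -
  have "\<exists>y. y \<in> L n \<and> dist q y < hausdorff_dist (L n) Q + inverse (real (Suc n))" for n
  proof -
    have "infdist q (L n) < hausdorff_dist (L n) Q + inverse (real (Suc n))"
      using infdist_le_hausdorff_dist'[OF compact_imp_bounded[OF Q(1)] Q(2) L, of n]
        inverse_positive_iff_positive[of "real (Suc n)"] by linarith
    then show ?thesis using exists_dist_less[OF L] by metis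
  qed
  then obtain f where f: "\<And>n. f n \<in> L n" "\<And>n. dist q (f n) < hausdorff_dist (L n) Q + inverse (real (Suc n))" by metis
  have "(\<lambda>n. hausdorff_dist (L n) Q + inverse (real (Suc n))) \<longlonglongrightarrow> 0 + 0"
    by (intro tendsto_add lim LIMSEQ_inverse_real_of_nat)
  then have up: "(\<lambda>n. hausdorff_dist (L n) Q + inverse (real (Suc n))) \<longlonglongrightarrow> 0" by simp
  have "(\<lambda>n. dist q (f n)) \<longlonglongrightarrow> 0"
    by (rule tendsto_sandwich[OF _ _ tendsto_const up]) (use f(2) in \<open>auto intro!: always_eventually less_imp_le simp del: of_nat_Suc\<close>)
  then have "f \<longlonglongrightarrow> q" unfolding tendsto_dist_iff[of f] by (simp add: dist_commute)
  then show thesis using that f(1) by blast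
qed

lemma limit_in_hausdorff_limit:
  assumes lim: "(\<lambda>n. hausdorff_dist (L n) Q) \<longlonglongrightarrow> 0" and L: "\<And>n. bounded (L n)"
    and Q: "closed Q" "Q \<noteq> {}" and f: "\<And>n. f n \<in> L n" "f \<longlonglongrightarrow> q"
  shows "q \<in> Q"
proof -
  have "(\<lambda>n. infdist (f n) Q) \<longlonglongrightarrow> infdist q Q" by (intro tendsto_infdist f)
  moreover have "(\<lambda>n. infdist (f n) Q) \<longlonglongrightarrow> 0"
    by (rule tendsto_sandwich[OF _ _ tendsto_const lim])
      (use infdist_le_hausdorff_dist[OF L f(1) Q(2)] in \<open>auto simp: infdist_nonneg\<close>)
  ultimately have "infdist q Q = 0" by (rule LIMSEQ_unique)
  then show ?thesis using Q in_closed_iff_infdist_zero by blast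
qed

text \<open>
  Disjoint open sets that separate \<open>Q\<close> would separate \<open>L n\<close> for large \<open>n\<close>.
\<close>

lemma connected_hausdorff_limit:
  assumes lim: "(\<lambda>n. hausdorff_dist (L n) Q) \<longlonglongrightarrow> 0"
    and L: "\<And>n. L n \<noteq> {}" "\<And>n. bounded (L n)" "\<And>n. connected (L n)" and Q: "compact Q" "Q \<noteq> {}"
  shows "connected Q"
proof (rule ccontr)
  assume "\<not> connected Q"
  then obtain A B where AB: "closed A" "closed B" "A \<inter> Q \<noteq> {}" "B \<inter> Q \<noteq> {}" "Q \<subseteq> A \<union> B" "A \<inter> B \<inter> Q = {}"
    unfolding connected_closed by blast
  have "closed Q" using Q(1) by (rule compact_imp_closed)
  then obtain U V where UV: "open U" "open V" "A \<inter> Q \<subseteq> U" "B \<inter> Q \<subseteq> V" "U \<inter> V = {}"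
    using t4_space[of "A \<inter> Q" "B \<inter> Q"] closed_Int AB(1,2,6) by (metis Int_assoc Int_left_commute Int_absorb)
  have hit: "\<forall>\<^sub>F n in sequentially. L n \<inter> W \<noteq> {}" if W: "open W" "q \<in> W" "q \<in> Q" for W q
  proof -
    obtain f where f: "\<And>n. f n \<in> L n" "f \<longlonglongrightarrow> q" using hausdorff_limit_point[OF lim L(1) Q(1) W(3)] by blast
    show ?thesis using topological_tendstoD[OF f(2) W(1,2)] by eventually_elim (use f(1) in blast)
  qed
  have "Q \<subseteq> U \<union> V" using AB(5) UV(3,4) by blast
  then obtain e where e: "e > 0" "(\<Union>q\<in>Q. ball q e) \<subseteq> U \<union> V"
    using compact_subset_open_imp_ball_epsilon_subset[OF Q(1), of "U \<union> V"] UV(1,2) by auto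
  have "\<forall>\<^sub>F n in sequentially. hausdorff_dist (L n) Q < e" using order_tendstoD(2)[OF lim e(1)] .
  then have "\<forall>\<^sub>F n in sequentially. L n \<subseteq> U \<union> V"
  proof eventually_elim
    case (elim n)
    show ?case
    proof
      fix x assume "x \<in> L n"
      then have "infdist x Q < e" using infdist_le_hausdorff_dist[OF L(2) _ Q(2)] elim by (metis le_less_trans)
      then obtain q where "q \<in> Q" "dist x q < e" using exists_dist_less[OF Q(2)] by metis
      then have "x \<in> (\<Union>q\<in>Q. ball q e)" by (auto simp: dist_commute)
      then show "x \<in> U \<union> V" using e(2) by blast
    qed
  qed
  moreover have "\<forall>\<^sub>F n in sequentially. L n \<inter> U \<noteq> {}" "\<forall>\<^sub>F n in sequentially. L n \<inter> V \<noteq> {}"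
    using AB(3,4) UV hit by blast+
  ultimately have "\<forall>\<^sub>F n in sequentially. False"
  proof eventually_elim
    case (elim n)
    then show False using connectedD[OF L(3)[of n] UV(1,2)] UV(5) by blast
  qed
  then show False by simp
qed

context metric_flow
begin

lemma invariant_hausdorff_limit:
  assumes lim: "(\<lambda>n. hausdorff_dist (L n) Q) \<longlonglongrightarrow> 0"
    and L: "\<And>n. L n \<noteq> {}" "\<And>n. bounded (L n)" "\<And>n. flow_invariant \<theta> (L n)" and Q: "compact Q"
  shows "flow_invariant \<theta> Q"
  unfolding invariant_iff
proof (intro ballI allI)
  fix q t assume "q \<in> Q"
  then obtain f where f: "\<And>n. f n \<in> L n" "f \<longlonglongrightarrow> q" using hausdorff_limit_point[OF lim L(1) Q] by blast
  show "\<theta> t q \<in> Q"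
  proof (rule limit_in_hausdorff_limit[OF lim L(2) compact_imp_closed[OF Q]])
    show "Q \<noteq> {}" using \<open>q \<in> Q\<close> by blast
    show "\<theta> t (f n) \<in> L n" for n using f(1) L(3) invariantD by blast
    show "(\<lambda>n. \<theta> t (f n)) \<longlonglongrightarrow> \<theta> t q" by (intro flow_tendsto tendsto_const f)
  qed
qed

text \<open>
  A Hausdorff limit of minimal sets shrinking to \<open>\<Lambda>\<close> is an invariant subset of \<open>\<Lambda>\<close>, hence all of
  \<open>\<Lambda>\<close>. So a neighbourhood in the phase space serves as a ball of the Hausdorff metric.
\<close>

lemma minimal_sets_near_hausdorff_close:
  assumes lc: "locally compact (UNIV :: 'a set)" and \<Lambda>: "compact \<Lambda>" "minimal_set \<theta> \<Lambda>" and "\<epsilon> > 0"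
  obtains N where "open N" "\<Lambda> \<subseteq> N" "\<And>Y. Y \<in> compact_minimal_sets_in \<theta> N \<Longrightarrow> hausdorff_dist \<Lambda> Y < \<epsilon>"
proof (rule ccontr)
  assume "\<not> thesis"
  with that have no: "\<And>N. open N \<Longrightarrow> \<Lambda> \<subseteq> N \<Longrightarrow>
      \<exists>Y. Y \<in> compact_minimal_sets_in \<theta> N \<and> \<not> hausdorff_dist \<Lambda> Y < \<epsilon>" by blast
  obtain C where C: "compact C" "\<Lambda> \<subseteq> interior C" using compact_nbhd_within[OF lc \<Lambda>(1) open_UNIV] by auto
  have ne: "\<Lambda> \<noteq> {}" "closed \<Lambda>" "flow_invariant \<theta> \<Lambda>" using \<Lambda>(2) unfolding minimal_set_def by auto
  define N where "N n = interior C \<inter> {x. infdist x \<Lambda> < inverse (real (Suc n))}" for n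
  have "open (N n)" "\<Lambda> \<subseteq> N n" for n
    unfolding N_def using C(2) by (auto intro!: open_Int open_Collect_less continuous_intros)
  then have "\<exists>Y. Y \<in> compact_minimal_sets_in \<theta> (N n) \<and> \<not> hausdorff_dist \<Lambda> Y < \<epsilon>" for n using no by blast
  then obtain Y where Y: "\<And>n. Y n \<in> compact_minimal_sets_in \<theta> (N n)" "\<And>n. \<not> hausdorff_dist \<Lambda> (Y n) < \<epsilon>" by metis
  have Y': "compact (Y n)" "minimal_set \<theta> (Y n)" "Y n \<noteq> {}" "flow_invariant \<theta> (Y n)" "Y n \<subseteq> N n" "Y n \<subseteq> C" for n
    using Y(1)[of n] interior_subset[of C] unfolding compact_minimal_sets_in_def minimal_set_def N_def by auto
  obtain Q r where r: "strict_mono (r :: nat \<Rightarrow> nat)" and Q: "compact Q" "Q \<noteq> {}"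
      and lim: "(\<lambda>n. hausdorff_dist (Y (r n)) Q) \<longlonglongrightarrow> 0"
    using hausdorff_convergent_subsequence[of C Y, OF C(1) Y'(3,6)] by metis
  have "Q \<subseteq> \<Lambda>"
  proof
    fix q assume "q \<in> Q"
    then obtain f where f: "\<And>n. f n \<in> Y (r n)" "f \<longlonglongrightarrow> q" using hausdorff_limit_point[OF lim Y'(3) Q(1)] by blast
    have "(\<lambda>n. infdist (f n) \<Lambda>) \<longlonglongrightarrow> infdist q \<Lambda>" by (intro tendsto_infdist f)
    moreover have "(\<lambda>n. infdist (f n) \<Lambda>) \<longlonglongrightarrow> 0"
    proof (rule tendsto_sandwich[OF _ _ tendsto_const LIMSEQ_inverse_real_of_nat])
      have "infdist (f n) \<Lambda> \<le> inverse (real (Suc n))" for n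
      proof -
        have "infdist (f n) \<Lambda> < inverse (real (Suc (r n)))" using f(1)[of n] Y'(5)[of "r n"] unfolding N_def by blast
        also have "\<dots> \<le> inverse (real (Suc n))" using seq_suble[OF r, of n] by (intro le_imp_inverse_le) auto
        finally show ?thesis by simp
      qed
      then show "\<forall>\<^sub>F n in sequentially. infdist (f n) \<Lambda> \<le> inverse (real (Suc n))" by simp
    qed (simp add: infdist_nonneg)
    ultimately have "infdist q \<Lambda> = 0" by (rule LIMSEQ_unique)
    then show "q \<in> \<Lambda>" using ne in_closed_iff_infdist_zero by blast
  qed
  moreover have "flow_invariant \<theta> Q"
    using invariant_hausdorff_limit[OF lim Y'(3) compact_imp_bounded[OF Y'(1)] Y'(4) Q(1)] .
  ultimately have "Q = \<Lambda>" using minimal_set_eq_of_subset \<Lambda>(2) Q compact_imp_closed by blast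
  then have "\<forall>\<^sub>F n in sequentially. hausdorff_dist (Y (r n)) \<Lambda> < \<epsilon>" using order_tendstoD(2)[OF lim \<open>\<epsilon> > 0\<close>] by simp
  then show False using Y(2) by (simp add: hausdorff_dist_commute)
qed

end

section \<open>Tame minimal sets accumulating at the given set\<close>

lemma subsequence_in_one_of_three:
  assumes "\<And>n::nat. A n \<or> B n \<or> C n"
  obtains r where "strict_mono (r :: nat \<Rightarrow> nat)"
    "(\<forall>n. A (r n)) \<or> (\<forall>n. B (r n)) \<or> (\<forall>n. C (r n))"
proof -
  have "infinite ({n. A n} \<union> ({n. B n} \<union> {n. C n}))"
    using assms infinite_UNIV_nat by (metis (mono_tags, lifting) UNIV_eq_I Un_iff mem_Collect_eq)
  then have "infinite {n. A n} \<or> infinite {n. B n} \<or> infinite {n. C n}" by simp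
  then show thesis using infinite_enumerate that by (metis mem_Collect_eq)
qed

context metric_flow
begin

lemma c_dense_in_itself_compact_minimal_sets:
  assumes lc: "locally compact (UNIV :: 'a set)" and S: "open S"
    and cont: "\<And>\<Lambda> N. \<Lambda> \<in> compact_minimal_sets_in \<theta> S \<Longrightarrow> open N \<Longrightarrow> \<Lambda> \<subseteq> N \<Longrightarrow>
        (UNIV :: real set) \<lesssim> compact_minimal_sets_in \<theta> N"
  shows "c_dense_in_itself (compact_minimal_sets_in \<theta> S)"
  unfolding c_dense_in_itself_def
proof (intro ballI allI impI)
  fix \<Lambda> and \<epsilon> :: real assume L: "\<Lambda> \<in> compact_minimal_sets_in \<theta> S" and "\<epsilon> > 0"
  then have L': "compact \<Lambda>" "minimal_set \<theta> \<Lambda>" "\<Lambda> \<subseteq> S" unfolding compact_minimal_sets_in_def by auto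
  obtain N where N: "open N" "\<Lambda> \<subseteq> N" "\<And>Y. Y \<in> compact_minimal_sets_in \<theta> N \<Longrightarrow> hausdorff_dist \<Lambda> Y < \<epsilon>"
    using minimal_sets_near_hausdorff_close[OF lc L'(1,2) \<open>\<epsilon> > 0\<close>] by metis
  have "(UNIV :: real set) \<lesssim> compact_minimal_sets_in \<theta> (N \<inter> S)"
    using cont[OF L, of "N \<inter> S"] N(1,2) S L'(3) by auto
  moreover have "compact_minimal_sets_in \<theta> (N \<inter> S) \<subseteq> {Y \<in> compact_minimal_sets_in \<theta> S. hausdorff_dist \<Lambda> Y < \<epsilon>}"
    using N(3) unfolding compact_minimal_sets_in_def by auto
  ultimately show "(UNIV :: real set) \<lesssim> {Y \<in> compact_minimal_sets_in \<theta> S. hausdorff_dist \<Lambda> Y < \<epsilon>}"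
    using lepoll_trans subset_imp_lepoll by blast
qed

text \<open>
  If no minimal set in \<open>S\<close> were tame, each of them would be approached by others, and the Cantor scheme
  would produce a continuum of them in \<open>N\<close>.
\<close>

lemma tame_minimal_set_of_few:
  assumes lc: "locally compact (UNIV :: 'a set)" and S: "open S" and dcc: "orbit_dcc \<theta> S"
    and \<Lambda>: "\<Lambda> \<in> compact_minimal_sets_in \<theta> S" and N: "open N" "\<Lambda> \<subseteq> N"
    and few: "\<not> (UNIV :: real set) \<lesssim> compact_minimal_sets_in \<theta> N"
  shows "\<exists>\<Lambda>'\<in>compact_minimal_sets_in \<theta> S. tame \<theta> \<Lambda>'"
proof (rule ccontr)
  assume no: "\<not> (\<exists>\<Lambda>'\<in>compact_minimal_sets_in \<theta> S. tame \<theta> \<Lambda>')"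
  have "(UNIV :: real set) \<lesssim> compact_minimal_sets_in \<theta> (N \<inter> S)"
  proof (rule continuum_of_minimal_sets[OF lc])
    show "open (N \<inter> S)" using S N(1) by blast
    show "orbit_dcc \<theta> (N \<inter> S)" by (rule orbit_dcc_mono[OF dcc]) blast
    show "compact_minimal_sets_in \<theta> (N \<inter> S) \<noteq> {}" using \<Lambda> N(2) unfolding compact_minimal_sets_in_def by blast
    fix M W assume M: "M \<in> compact_minimal_sets_in \<theta> (N \<inter> S)" and W: "open W" "M \<subseteq> W"
    have M': "compact M" "minimal_set \<theta> M" "M \<subseteq> N \<inter> S" "flow_invariant \<theta> M"
      using M unfolding compact_minimal_sets_in_def minimal_set_def by auto
    obtain C where C: "compact C" "M \<subseteq> interior C" "C \<subseteq> N \<inter> S \<inter> W"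
      using compact_nbhd_within[OF lc M'(1), of "N \<inter> S \<inter> W"] S N(1) W M'(3) by auto
    have "orbit_dcc \<theta> (C - M)" by (rule orbit_dcc_mono[OF dcc]) (use C(3) in blast)
    moreover have "\<not> tame \<theta> M" using no M unfolding compact_minimal_sets_in_def by blast
    ultimately obtain M2 where "compact M2" "minimal_set \<theta> M2" "M2 \<subseteq> C - M"
      using minimal_set_near_of_not_tame[OF lc M'(1,4) C(1,2)] by blast
    moreover have "M2 \<noteq> {}" using calculation(2) unfolding minimal_set_def by blast
    ultimately show "\<exists>M'. M' \<in> compact_minimal_sets_in \<theta> (N \<inter> S \<inter> W) \<and> M' \<noteq> M"
      using C(3) unfolding compact_minimal_sets_in_def by blast
  qed
  moreover have "compact_minimal_sets_in \<theta> (N \<inter> S) \<subseteq> compact_minimal_sets_in \<theta> N"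
    unfolding compact_minimal_sets_in_def by auto
  ultimately show False using few lepoll_trans subset_imp_lepoll by blast
qed

lemma tame_minimal_sets_near:
  assumes lc: "locally compact (UNIV :: 'a set)" and K: "compact K" "flow_invariant \<theta> K"
    and dcc: "nbhd U1 K" "orbit_dcc \<theta> (U1 - K)" and nt: "\<not> tame \<theta> K"
    and few: "\<not> (\<exists>U\<^sub>0. nbhd U\<^sub>0 K \<and>
          (\<forall>U. open U \<and> K \<subseteq> U \<and> U \<subseteq> U\<^sub>0 \<longrightarrow>
             compact_minimal_sets_in \<theta> (U - K) \<noteq> {}
             \<and> c_dense_in_itself (compact_minimal_sets_in \<theta> (U - K))
             \<and> (\<forall>\<Lambda> \<in> compact_minimal_sets_in \<theta> (U - K). \<forall>N. nbhd N \<Lambda> \<longrightarrow>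
                  (UNIV :: real set) \<lesssim> compact_minimal_sets_in \<theta> N)))"
    and W: "open W" "K \<subseteq> W"
  shows "\<exists>\<Lambda>\<in>compact_minimal_sets_in \<theta> (W - K). tame \<theta> \<Lambda>"
proof -
  have "nbhd (W \<inter> interior U1) K" using W dcc(1) unfolding nbhd_def by (simp add: interior_open)
  then obtain U where U: "open U" "K \<subseteq> U" "U \<subseteq> W \<inter> interior U1"
    and neg: "\<not> (compact_minimal_sets_in \<theta> (U - K) \<noteq> {}
             \<and> c_dense_in_itself (compact_minimal_sets_in \<theta> (U - K))
             \<and> (\<forall>\<Lambda> \<in> compact_minimal_sets_in \<theta> (U - K). \<forall>N. nbhd N \<Lambda> \<longrightarrow>
                  (UNIV :: real set) \<lesssim> compact_minimal_sets_in \<theta> N))"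
    using few by meson
  have S: "open (U - K)" using U(1) compact_imp_closed[OF K(1)] by (rule open_Diff)
  have dccS: "orbit_dcc \<theta> (U - K)" by (rule orbit_dcc_mono[OF dcc(2)]) (use U(3) interior_subset[of U1] in blast)
  obtain C where C: "compact C" "K \<subseteq> interior C" "C \<subseteq> U" using compact_nbhd_within[OF lc K(1) U(1,2)] .
  have "orbit_dcc \<theta> (C - K)" by (rule orbit_dcc_mono[OF dccS]) (use C(3) in blast)
  then obtain \<Lambda> where "compact \<Lambda>" "minimal_set \<theta> \<Lambda>" "\<Lambda> \<subseteq> C - K"
    using minimal_set_near_of_not_tame[OF lc K C(1,2) _ nt] by blast
  then have "compact_minimal_sets_in \<theta> (U - K) \<noteq> {}" using C(3) unfolding compact_minimal_sets_in_def by blast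
  have "\<exists>\<Lambda> N. \<Lambda> \<in> compact_minimal_sets_in \<theta> (U - K) \<and> open N \<and> \<Lambda> \<subseteq> N \<and>
      \<not> (UNIV :: real set) \<lesssim> compact_minimal_sets_in \<theta> N"
  proof (rule ccontr)
    assume "\<not> ?thesis"
    then have all: "\<And>\<Lambda> N. \<Lambda> \<in> compact_minimal_sets_in \<theta> (U - K) \<Longrightarrow> open N \<Longrightarrow> \<Lambda> \<subseteq> N \<Longrightarrow>
        (UNIV :: real set) \<lesssim> compact_minimal_sets_in \<theta> N" by blast
    have "(UNIV :: real set) \<lesssim> compact_minimal_sets_in \<theta> N"
      if "\<Lambda> \<in> compact_minimal_sets_in \<theta> (U - K)" "nbhd N \<Lambda>" for \<Lambda> N
    proof -
      have "(UNIV :: real set) \<lesssim> compact_minimal_sets_in \<theta> (interior N)"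
        using all[OF that(1) open_interior] that(2) unfolding nbhd_def .
      moreover have "compact_minimal_sets_in \<theta> (interior N) \<subseteq> compact_minimal_sets_in \<theta> N"
        using interior_subset unfolding compact_minimal_sets_in_def by blast
      ultimately show ?thesis using lepoll_trans subset_imp_lepoll by blast
    qed
    moreover have "c_dense_in_itself (compact_minimal_sets_in \<theta> (U - K))"
      by (rule c_dense_in_itself_compact_minimal_sets[OF lc S]) (rule all)
    ultimately show False
      using neg \<open>compact_minimal_sets_in \<theta> (U - K) \<noteq> {}\<close> by blast
  qed
  then obtain \<Lambda>' where "\<Lambda>' \<in> compact_minimal_sets_in \<theta> (U - K)" "tame \<theta> \<Lambda>'"
    using tame_minimal_set_of_few[OF lc S dccS] by blast
  then show ?thesis using U(3) unfolding compact_minimal_sets_in_def by blast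
qed

text \<open>
  Successive subsequences fix the dynamical class of the minimal sets, then the way in which they are tame,
  and finally make them converge. The limit lies in the frontier because the sets shrink to \<open>K\<close> from
  outside.
\<close>

lemma tame_minimal_sets_accumulate:
  assumes lc: "locally compact (UNIV :: 'a set)" and K: "compact K" "K \<noteq> {}"
    and near: "\<And>W. open W \<Longrightarrow> K \<subseteq> W \<Longrightarrow> \<exists>\<Lambda>\<in>compact_minimal_sets_in \<theta> (W - K). tame \<theta> \<Lambda>"
  shows "\<exists>Q (\<Lambda> :: nat \<Rightarrow> 'a set).
          Q \<noteq> {} \<and> compact Q \<and> connected Q \<and> flow_invariant \<theta> Q \<and> Q \<subseteq> frontier K
          \<and> (\<forall>n. compact (\<Lambda> n) \<and> minimal_set \<theta> (\<Lambda> n) \<and> \<Lambda> n \<subseteq> - K)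
          \<and> (\<lambda>n. hausdorff_dist (\<Lambda> n) Q) \<longlonglongrightarrow> 0
          \<and> ((\<forall>n. equilibrium_orbit \<theta> (\<Lambda> n))
             \<or> (\<forall>n. periodic_orbit \<theta> (\<Lambda> n))
             \<or> (\<forall>n. aperiodic_minimal_set \<theta> (\<Lambda> n)))
          \<and> ((\<forall>n. attractor \<theta> (\<Lambda> n))
             \<or> (\<forall>n. repeller \<theta> (\<Lambda> n))
             \<or> (\<forall>n. isolated_from_minimal_sets \<theta> (\<Lambda> n) \<and> stagnant \<theta> (\<Lambda> n)))"
proof -
  obtain C where C: "compact C" "K \<subseteq> interior C" using compact_nbhd_within[OF lc K(1) open_UNIV] by auto
  define W where "W n = interior C \<inter> {x. infdist x K < inverse (real (Suc n))}" for n
  have "open (W n)" "K \<subseteq> W n" for n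
    unfolding W_def using C(2) by (auto intro!: open_Int open_Collect_less continuous_intros)
  then have "\<exists>\<Lambda>. \<Lambda> \<in> compact_minimal_sets_in \<theta> (W n - K) \<and> tame \<theta> \<Lambda>" for n using near by blast
  then obtain M where M: "\<And>n. M n \<in> compact_minimal_sets_in \<theta> (W n - K)" "\<And>n. tame \<theta> (M n)" by metis
  then have Mmin: "\<And>n. minimal_set \<theta> (M n)" unfolding compact_minimal_sets_in_def by blast
  obtain r1 where r1: "strict_mono (r1 :: nat \<Rightarrow> nat)"
    "(\<forall>n. equilibrium_orbit \<theta> (M (r1 n))) \<or> (\<forall>n. periodic_orbit \<theta> (M (r1 n)))
      \<or> (\<forall>n. aperiodic_minimal_set \<theta> (M (r1 n)))"
    using subsequence_in_one_of_three[of "\<lambda>n. equilibrium_orbit \<theta> (M n)" "\<lambda>n. periodic_orbit \<theta> (M n)"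
        "\<lambda>n. aperiodic_minimal_set \<theta> (M n)"] Mmin unfolding aperiodic_minimal_set_def by blast
  obtain r2 where r2: "strict_mono (r2 :: nat \<Rightarrow> nat)"
    "(\<forall>n. attractor \<theta> (M (r1 (r2 n)))) \<or> (\<forall>n. repeller \<theta> (M (r1 (r2 n))))
      \<or> (\<forall>n. isolated_from_minimal_sets \<theta> (M (r1 (r2 n))) \<and> stagnant \<theta> (M (r1 (r2 n))))"
    using subsequence_in_one_of_three[of "\<lambda>n. attractor \<theta> (M (r1 n))" "\<lambda>n. repeller \<theta> (M (r1 n))"
        "\<lambda>n. isolated_from_minimal_sets \<theta> (M (r1 n)) \<and> stagnant \<theta> (M (r1 n))"] M(2) unfolding tame_def by blast
  have M': "compact (M n)" "M n \<noteq> {}" "flow_invariant \<theta> (M n)" "M n \<subseteq> W n - K" "M n \<subseteq> C" for n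
    using M(1)[of n] interior_subset[of C] unfolding compact_minimal_sets_in_def minimal_set_def W_def by auto
  obtain Q r3 where r3: "strict_mono (r3 :: nat \<Rightarrow> nat)" and Q: "compact Q" "Q \<noteq> {}"
      and lim: "(\<lambda>n. hausdorff_dist (M (r1 (r2 (r3 n)))) Q) \<longlonglongrightarrow> 0"
    using hausdorff_convergent_subsequence[of C "\<lambda>n. M (r1 (r2 n))", OF C(1) M'(2,5)] by metis
  define \<Lambda> where "\<Lambda> n = M (r1 (r2 (r3 n)))" for n
  have lim\<Lambda>: "(\<lambda>n. hausdorff_dist (\<Lambda> n) Q) \<longlonglongrightarrow> 0" unfolding \<Lambda>_def by (rule lim)
  have \<Lambda>: "compact (\<Lambda> n)" "\<Lambda> n \<noteq> {}" "bounded (\<Lambda> n)" "connected (\<Lambda> n)" "flow_invariant \<theta> (\<Lambda> n)" "minimal_set \<theta> (\<Lambda> n)" for n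
    using M' Mmin minimal_set_connected compact_imp_bounded unfolding \<Lambda>_def by blast+
  have \<Lambda>W: "\<Lambda> n \<subseteq> - K" "x \<in> \<Lambda> n \<Longrightarrow> infdist x K \<le> inverse (real (Suc n))" for n x
  proof -
    let ?k = "r1 (r2 (r3 n))"
    have "n \<le> ?k" using seq_suble[OF r1(1)] seq_suble[OF r2(1)] seq_suble[OF r3] le_trans by metis
    then have le: "inverse (real (Suc ?k)) \<le> inverse (real (Suc n))" by (intro le_imp_inverse_le) auto
    show "\<Lambda> n \<subseteq> - K" using M'(4)[of ?k] unfolding \<Lambda>_def by blast
    assume "x \<in> \<Lambda> n"
    then have "infdist x K < inverse (real (Suc ?k))" using M'(4)[of ?k] unfolding \<Lambda>_def W_def by blast
    with le show "infdist x K \<le> inverse (real (Suc n))" by linarith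
  qed
  have "Q \<subseteq> frontier K"
  proof
    fix q assume "q \<in> Q"
    then obtain f where f: "\<And>n. f n \<in> \<Lambda> n" "f \<longlonglongrightarrow> q" using hausdorff_limit_point[OF lim\<Lambda> \<Lambda>(2) Q(1)] by blast
    have "(\<lambda>n. infdist (f n) K) \<longlonglongrightarrow> infdist q K" by (intro tendsto_infdist f)
    moreover have "(\<lambda>n. infdist (f n) K) \<longlonglongrightarrow> 0"
      by (rule tendsto_sandwich[OF _ _ tendsto_const LIMSEQ_inverse_real_of_nat])
        (use \<Lambda>W(2) f(1) in \<open>auto simp: infdist_nonneg simp del: of_nat_Suc\<close>)
    ultimately have "infdist q K = 0" by (rule LIMSEQ_unique)
    then have "q \<in> K" using K compact_imp_closed in_closed_iff_infdist_zero by blast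
    moreover have "f n \<in> - K" for n using f(1) \<Lambda>W(1) by blast
    then have "q \<in> closure (- K)" using f(2) unfolding closure_sequential by blast
    ultimately show "q \<in> frontier K" unfolding frontier_closures using closure_subset by blast
  qed
  moreover have "connected Q" by (rule connected_hausdorff_limit[OF lim\<Lambda> \<Lambda>(2,3,4) Q])
  moreover have "flow_invariant \<theta> Q" by (rule invariant_hausdorff_limit[OF lim\<Lambda> \<Lambda>(2,3,5) Q(1)])
  moreover have "(\<forall>n. equilibrium_orbit \<theta> (\<Lambda> n)) \<or> (\<forall>n. periodic_orbit \<theta> (\<Lambda> n))
             \<or> (\<forall>n. aperiodic_minimal_set \<theta> (\<Lambda> n))"
    using r1(2) unfolding \<Lambda>_def by blast
  moreover have "(\<forall>n. attractor \<theta> (\<Lambda> n)) \<or> (\<forall>n. repeller \<theta> (\<Lambda> n))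
             \<or> (\<forall>n. isolated_from_minimal_sets \<theta> (\<Lambda> n) \<and> stagnant \<theta> (\<Lambda> n))"
    using r2(2) unfolding \<Lambda>_def by blast
  moreover have "\<forall>n. compact (\<Lambda> n) \<and> minimal_set \<theta> (\<Lambda> n) \<and> \<Lambda> n \<subseteq> - K" using \<Lambda> \<Lambda>W(1) by blast
  ultimately show ?thesis
    using Q lim\<Lambda> by (intro exI[of _ Q] exI[of _ \<Lambda>] conjI)
qed

end

theorem mainTheorem1:
  fixes \<theta> :: "real \<Rightarrow> 'a::metric_space \<Rightarrow> 'a" and K :: "'a set"
  assumes "locally compact (UNIV :: 'a set)"
    and "connected (UNIV :: 'a set)"
    and "C0_flow \<theta>"
    and "compact K" and "flow_invariant \<theta> K" and "K \<noteq> UNIV"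
  shows
    "attractor \<theta> K
     \<or> repeller \<theta> K
     \<or> (isolated_from_minimal_sets \<theta> K \<and> stagnant \<theta> K)
     \<or> (\<exists>Q (\<Lambda> :: nat \<Rightarrow> 'a set).
          Q \<noteq> {} \<and> compact Q \<and> connected Q \<and> flow_invariant \<theta> Q \<and> Q \<subseteq> frontier K
          \<and> (\<forall>n. compact (\<Lambda> n) \<and> minimal_set \<theta> (\<Lambda> n) \<and> \<Lambda> n \<subseteq> - K)
          \<and> (\<lambda>n. hausdorff_dist (\<Lambda> n) Q) \<longlonglongrightarrow> 0
          \<and> ((\<forall>n. equilibrium_orbit \<theta> (\<Lambda> n))
             \<or> (\<forall>n. periodic_orbit \<theta> (\<Lambda> n))
             \<or> (\<forall>n. aperiodic_minimal_set \<theta> (\<Lambda> n)))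
          \<and> ((\<forall>n. attractor \<theta> (\<Lambda> n))
             \<or> (\<forall>n. repeller \<theta> (\<Lambda> n))
             \<or> (\<forall>n. isolated_from_minimal_sets \<theta> (\<Lambda> n) \<and> stagnant \<theta> (\<Lambda> n))))
     \<or> (\<exists>U\<^sub>0. nbhd U\<^sub>0 K \<and>
          (\<forall>U. open U \<and> K \<subseteq> U \<and> U \<subseteq> U\<^sub>0 \<longrightarrow>
             compact_minimal_sets_in \<theta> (U - K) \<noteq> {}
             \<and> c_dense_in_itself (compact_minimal_sets_in \<theta> (U - K))
             \<and> (\<forall>\<Lambda> \<in> compact_minimal_sets_in \<theta> (U - K). \<forall>N. nbhd N \<Lambda> \<longrightarrow>
                  (UNIV :: real set) \<lesssim> compact_minimal_sets_in \<theta> N)))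
     \<or> (\<forall>U. nbhd U K \<longrightarrow>
          (\<exists>x :: nat \<Rightarrow> 'a. \<forall>n.
             flow_orbit \<theta> (x n) \<subseteq> U - K
             \<and> closure (flow_orbit \<theta> (x (Suc n))) \<subset> closure (flow_orbit \<theta> (x n))))"
proof (rule ccontr)
  assume not: "\<not> ?thesis"
  note neg = not[unfolded de_Morgan_disj]
  interpret metric_flow \<theta> by unfold_locales (rule assms(3))
  \<comment> \<open>the negations of all alternatives are the conjuncts of \<open>neg\<close>\<close>
  have nt: "\<not> tame \<theta> K" using not unfolding tame_def by blast
  have "K \<noteq> {}"
  proof
    assume "K = {}"
    then have "attractor \<theta> K"
      unfolding attractor_def flow_stable_def nbhd_def by (auto intro: exI[of _ "{}"])
    with nt show False unfolding tame_def by blast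
  qed
  have "\<not> (\<forall>U. nbhd U K \<longrightarrow> \<not> orbit_dcc \<theta> (U - K))"
    unfolding orbit_dcc_def not_not using neg by (elim conjE)
  then obtain U1 where U1: "nbhd U1 K" "orbit_dcc \<theta> (U1 - K)" by blast
  have near: "\<exists>\<Lambda>\<in>compact_minimal_sets_in \<theta> (W - K). tame \<theta> \<Lambda>" if "open W" "K \<subseteq> W" for W
    by (rule tame_minimal_sets_near[OF assms(1,4,5) U1 nt _ that]) (use neg in \<open>elim conjE\<close>)
  show False
    by (rule notE[OF _ tame_minimal_sets_accumulate[OF assms(1,4) \<open>K \<noteq> {}\<close> near]])
      (use neg in \<open>elim conjE\<close>)
qed

end
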